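(* Let $n\ge 1$, let $s,s_2\geq 0$ be real numbers with $s\notin\mathbb{Z}$, and let $p_1,p_2,p>1$ be real numbers. If $W^{s,p_1}(\mathbb{R}^n)\times W^{s_2,p_2}(\mathbb{R}^n)\hookrightarrow W^{s,p}(\mathbb{R}^n)$, i.e. if $uv\in W^{s,p}(\mathbb{R}^n)$ for all $u\in W^{s,p_1}(\mathbb{R}^n)$, $v\in W^{s_2,p_2}(\mathbb{R}^n)$ and there is a constant $C$ with $\|uv\|_{W^{s,p}(\mathbb{R}^n)}\le C\|u\|_{W^{s,p_1}(\mathbb{R}^n)}\|v\|_{W^{s_2,p_2}(\mathbb{R}^n)}$ for all such $u,v$, then $p_1\leq p$.
   Context: Sobolev-Slobodeckij spaces on $\mathbb{R}^n$, for $1\le p<\infty$: for $k\in\mathbb{N}_0$, $W^{k,p}(\mathbb{R}^n)$ is the set of $u\in L^p(\mathbb{R}^n)$ with $\|u\|_{W^{k,p}}:=\sum_{|\nu|\le k}\|\partial^\nu u\|_{L^p}<\infty$ (weak derivatives). For $\theta\in(0,1)$ put $|u|_{W^{\theta,p}}:=\left(\iint_{\mathbb{R}^n\times\mathbb{R}^n}\frac{|u(x)-u(y)|^p}{|x-y|^{n+\theta p}}\,dx\,dy\right)^{1/p}$. For $s=k+\theta$ with $k\in\mathbb{N}_0$, $\theta\in(0,1)$, $W^{s,p}(\mathbb{R}^n)$ is the set of $u\in W^{k,p}(\mathbb{R}^n)$ with $\|u\|_{W^{s,p}}:=\|u\|_{W^{k,p}}+\sum_{|\nu|=k}|\partial^\nu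 u|_{W^{\theta,p}}<\infty$. *)

theory Defs
  imports "HOL-Analysis.Analysis"
begin

text \<open>
  Functions on \<open>\<real>\<^sup>n\<close> are real-valued functions on \<^typ>\<open>real ^ 'n\<close>, with \<open>n = CARD('n)\<close>.  We work with
  representatives rather than with classes modulo null sets; all notions below are invariant under
  changes on a null set.
\<close>

subsection \<open>Multi-indices and classical derivatives\<close>

type_synonym 'n multi_index = "'n \<Rightarrow> nat"

definition mi_order :: "('n::finite) multi_index \<Rightarrow> nat" where
  "mi_order \<nu> = (\<Sum>i\<in>UNIV. \<nu> i)"

lemma finite_mi_order_le: "finite {\<nu> :: ('n::finite) multi_index. mi_order \<nu> \<le> k}"
proof (rule finite_subset)
  show "{\<nu> :: 'n multi_index. mi_order \<nu> \<le> k} \<subseteq> PiE UNIV (\<lambda>_. {..k})"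
  proof
    fix \<nu> :: "'n multi_index" assume "\<nu> \<in> {\<nu>. mi_order \<nu> \<le> k}"
    moreover have "\<nu> i \<le> mi_order \<nu>" for i
      unfolding mi_order_def by (rule member_le_sum) auto
    ultimately show "\<nu> \<in> PiE UNIV (\<lambda>_. {..k})"
      by (auto intro: order_trans)
  qed
  show "finite (PiE (UNIV :: 'n set) (\<lambda>_. {..k}))"
    by (rule finite_PiE) auto
qed

lemma finite_mi_order_eq: "finite {\<nu> :: ('n::finite) multi_index. mi_order \<nu> = k}"
  by (rule finite_subset[OF _ finite_mi_order_le[of k]]) auto

definition pderiv_dir :: "'n \<Rightarrow> (real ^ 'n::finite \<Rightarrow> real) \<Rightarrow> real ^ 'n \<Rightarrow> real" where
  "pderiv_dir i f = (\<lambda>x. deriv (\<lambda>t. f (x + t *\<^sub>R axis i 1)) 0)"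

text \<open>
  An index type carries no order, so the order in which the partial derivatives are taken is that
  of a fixed enumeration of the coordinates.  For the smooth functions to which it is applied the
  choice is irrelevant.
\<close>
definition coords :: "'n::finite list" where
  "coords = (SOME is. set is = UNIV \<and> distinct is)"

lemma coords: "set (coords :: 'n::finite list) = UNIV" "distinct (coords :: 'n list)"
proof -
  have "\<exists>is. set is = (UNIV :: 'n set) \<and> distinct is"
    by (rule finite_distinct_list) simp
  from someI_ex[OF this]
  show "set (coords :: 'n::finite list) = UNIV" "distinct (coords :: 'n list)"
    by (auto simp: coords_def)
qed

definition mi_deriv :: "'n multi_index \<Rightarrow> (real ^ 'n::finite \<Rightarrow> real) \<Rightarrow> real ^ 'n \<Rightarrow> real" where
  "mi_deriv \<nu> f = foldr (\<lambda>i. pderiv_dir i ^^ \<nu> i) coords f"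

fun C_k :: "nat \<Rightarrow> (real ^ 'n::finite \<Rightarrow> real) \<Rightarrow> bool" where
  "C_k 0 f \<longleftrightarrow> continuous_on UNIV f"
| "C_k (Suc k) f \<longleftrightarrow> (\<forall>x. f differentiable (at x)) \<and> (\<forall>i. C_k k (pderiv_dir i f))"

definition test_function :: "(real ^ 'n::finite \<Rightarrow> real) \<Rightarrow> bool" where
  "test_function \<phi> \<longleftrightarrow> (\<forall>k. C_k k \<phi>) \<and> compact (closure {x. \<phi> x \<noteq> 0})"

subsection \<open>Weak derivatives\<close>

definition locally_integrable :: "(real ^ 'n::finite \<Rightarrow> real) \<Rightarrow> bool" where
  "locally_integrable u \<longleftrightarrow> (\<forall>K. compact K \<longrightarrow> set_integrable lebesgue K u)"

definition has_weak_deriv ::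
    "'n multi_index \<Rightarrow> (real ^ 'n::finite \<Rightarrow> real) \<Rightarrow> (real ^ 'n \<Rightarrow> real) \<Rightarrow> bool" where
  "has_weak_deriv \<nu> u v \<longleftrightarrow> locally_integrable u \<and> locally_integrable v \<and>
     (\<forall>\<phi>. test_function \<phi> \<longrightarrow>
        (LINT x|lebesgue. u x * mi_deriv \<nu> \<phi> x) =
        (-1) ^ mi_order \<nu> * (LINT x|lebesgue. v x * \<phi> x))"

text \<open>A weak derivative is unique up to a null set; this picks a representative.\<close>
definition weak_deriv ::
    "'n multi_index \<Rightarrow> (real ^ 'n::finite \<Rightarrow> real) \<Rightarrow> real ^ 'n \<Rightarrow> real" where
  "weak_deriv \<nu> u = (SOME v. has_weak_deriv \<nu> u v)"

subsection \<open>Lebesgue and Sobolev-Slobodeckij spaces\<close>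

definition Lp_space :: "real \<Rightarrow> (real ^ 'n::finite \<Rightarrow> real) set" where
  "Lp_space p = {u. u \<in> borel_measurable lebesgue \<and> integrable lebesgue (\<lambda>x. \<bar>u x\<bar> powr p)}"

definition Lp_norm :: "real \<Rightarrow> (real ^ 'n::finite \<Rightarrow> real) \<Rightarrow> real" where
  "Lp_norm p u = (LINT x|lebesgue. \<bar>u x\<bar> powr p) powr (1 / p)"

definition Sobolev_int :: "nat \<Rightarrow> real \<Rightarrow> (real ^ 'n::finite \<Rightarrow> real) set" where
  "Sobolev_int k p = {u \<in> Lp_space p.
     \<forall>\<nu>. mi_order \<nu> \<le> k \<longrightarrow> (\<exists>v. has_weak_deriv \<nu> u v) \<and> weak_deriv \<nu> u \<in> Lp_space p}"

definition Sobolev_int_norm :: "nat \<Rightarrow> real \<Rightarrow> (real ^ 'n::finite \<Rightarrow> real) \<Rightarrow> real" where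
  "Sobolev_int_norm k p u = (\<Sum>\<nu> | mi_order \<nu> \<le> k. Lp_norm p (weak_deriv \<nu> u))"

text \<open>
  The integrand of the Slobodeckij seminorm, on \<open>\<real>\<^sup>n \<times> \<real>\<^sup>n\<close>.  On the diagonal, a null set, it is
  \<open>0 / 0 = 0\<close>.
\<close>
definition Slobodeckij_integrand ::
    "real \<Rightarrow> real \<Rightarrow> (real ^ 'n::finite \<Rightarrow> real) \<Rightarrow> (real ^ 'n) \<times> (real ^ 'n) \<Rightarrow> real" where
  "Slobodeckij_integrand \<theta> p u =
     (\<lambda>(x, y). \<bar>u x - u y\<bar> powr p / norm (x - y) powr (real CARD('n) + \<theta> * p))"

definition Slobodeckij_seminorm :: "real \<Rightarrow> real \<Rightarrow> (real ^ 'n::finite \<Rightarrow> real) \<Rightarrow> real" where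
  "Slobodeckij_seminorm \<theta> p u =
     (LINT z|lebesgue. Slobodeckij_integrand \<theta> p u z) powr (1 / p)"

text \<open>
  For \<open>s \<ge> 0\<close> we have \<open>s = k + \<theta>\<close> with \<open>k = nat \<lfloor>s\<rfloor>\<close> and \<open>\<theta> = frac s\<close>, and \<open>\<theta> = 0\<close> iff \<open>s\<close> is an
  integer.  Finiteness of a norm is expressed by integrability, since the real-valued integral of a
  non-integrable function is 0; the norm is therefore meaningful only on the space itself.
\<close>
definition Sobolev :: "real \<Rightarrow> real \<Rightarrow> (real ^ 'n::finite \<Rightarrow> real) set" where
  "Sobolev s p =
     (if s \<in> \<int> then Sobolev_int (nat \<lfloor>s\<rfloor>) p
      else {u \<in> Sobolev_int (nat \<lfloor>s\<rfloor>) p. \<forall>\<nu>. mi_order \<nu> = nat \<lfloor>s\<rfloor> \<longrightarrow>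
              integrable lebesgue (Slobodeckij_integrand (frac s) p (weak_deriv \<nu> u))})"

definition Sobolev_norm :: "real \<Rightarrow> real \<Rightarrow> (real ^ 'n::finite \<Rightarrow> real) \<Rightarrow> real" where
  "Sobolev_norm s p u =
     (if s \<in> \<int> then Sobolev_int_norm (nat \<lfloor>s\<rfloor>) p u
      else Sobolev_int_norm (nat \<lfloor>s\<rfloor>) p u +
             (\<Sum>\<nu> | mi_order \<nu> = nat \<lfloor>s\<rfloor>. Slobodeckij_seminorm (frac s) p (weak_deriv \<nu> u)))"

end

theory Submission
  imports Defs
begin

text \<open>
  Multiplication by one fixed smooth cut-off \<open>\<psi>\<close> already forces \<open>p1 \<le> p\<close>.  Write \<open>s = k + \<theta>\<close> and test
  with the lacunary sums \<open>u\<^sub>N(x) = \<psi>(x) (\<Sum>j<N. b powr (- s j) * cos (b^j x\<^sub>1))\<close> for a large base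
  \<open>b\<close>.  Their derivatives of order \<open>k\<close> behave like a Weierstrass function: increments over distances
  of size \<open>b^(-m)\<close>, \<open>m < N\<close>, are at most of size \<open>b powr (- \<theta> m)\<close>, and are of exactly that size for a
  fixed proportion of the directions.  Hence each of the \<open>N\<close> shells contributes an amount
  of order one to the Slobodeckij integral, whatever the exponent: the norm of \<open>u\<^sub>N\<close> in \<open>W(s, p1)\<close> is
  \<open>O(N powr (1 / p1))\<close>, whereas that of \<open>u\<^sub>N \<psi>\<close> in \<open>W(s, p)\<close> is at least a multiple of
  \<open>N powr (1 / p)\<close>.
\<close>

subsection \<open>Partial derivatives and quantitative bounds\<close>

text \<open>Every test function here is smooth with compact support and so lies in all the spaces
  involved; exponents can be told apart only by the growth of the norms in \<open>N\<close>, and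
  every constant has to be uniform in \<open>N\<close>. The full series is no substitute, as its
  seminorm is infinite for every exponent. A shell contributes order one because increments of size
  |h|^\<theta>, raised to the power q, turn the weight |h|^(-n - \<theta> q) into |h|^(-n), whose
  integral over a shell depends only on the ratio of the radii. As the second factor is fixed,
  \<open>s2\<close> and \<open>p2\<close> enter only through one number, the norm of \<psi>. For the
  lower bound one pure derivative of order \<open>k\<close> is enough. The main obstacle is that
  \<open>weak_deriv\<close> is a choice among representatives. No norm can be evaluated before weak
  derivatives are known to be unique almost everywhere, and null sets of R^n have to be carried over
  to null sets of R^n x R^n. Hence the part on bump functions and integration by parts.\<close>

lemma has_derivative_along_axis:
  assumes "(f has_derivative f') (at x)"
  shows "((\<lambda>t. f (x + t *\<^sub>R axis i 1)) has_real_derivative f' (axis i 1)) (at 0)"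
proof -
  have "((\<lambda>t. f (x + t *\<^sub>R axis i 1)) has_derivative (\<lambda>t. f' (t *\<^sub>R axis i 1))) (at 0)"
    by (rule has_derivative_compose[where g = f and f = "\<lambda>t. x + t *\<^sub>R axis i 1"])
       (use assms in \<open>auto intro!: derivative_eq_intros\<close>)
  moreover have "(\<lambda>t. f' (t *\<^sub>R axis i 1)) = (\<lambda>t. t * f' (axis i 1))"
    using assms by (auto simp: linear_simps(5) dest!: has_derivative_bounded_linear)
  ultimately show ?thesis
    by (simp add: has_field_derivative_def mult.commute[of _ "f' (axis i 1)"])
qed

lemma pderiv_dir_eq: "(f has_derivative f') (at x) \<Longrightarrow> pderiv_dir i f x = f' (axis i 1)"
  unfolding pderiv_dir_def by (rule DERIV_imp_deriv[OF has_derivative_along_axis])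

lemma pderiv_dir_add:
  assumes "\<And>x. f differentiable (at x)" "\<And>x. g differentiable (at x)"
  shows "pderiv_dir i (\<lambda>x. f x + g x) = (\<lambda>x. pderiv_dir i f x + pderiv_dir i g x)"
proof
  fix x
  obtain f' g' where *: "(f has_derivative f') (at x)" "(g has_derivative g') (at x)"
    using assms unfolding differentiable_def by blast
  thus "pderiv_dir i (\<lambda>x. f x + g x) x = pderiv_dir i f x + pderiv_dir i g x"
    using pderiv_dir_eq[OF has_derivative_add[OF *]] pderiv_dir_eq[OF *(1)] pderiv_dir_eq[OF *(2)]
    by simp
qed

lemma pderiv_dir_mult:
  assumes "\<And>x. f differentiable (at x)" "\<And>x. g differentiable (at x)"
  shows "pderiv_dir i (\<lambda>x. f x * g x) = (\<lambda>x. pderiv_dir i f x * g x + f x * pderiv_dir i g x)"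
proof
  fix x
  obtain f' g' where *: "(f has_derivative f') (at x)" "(g has_derivative g') (at x)"
    using assms unfolding differentiable_def by blast
  show "pderiv_dir i (\<lambda>x. f x * g x) x = pderiv_dir i f x * g x + f x * pderiv_dir i g x"
    using pderiv_dir_eq[OF has_derivative_mult[OF *]] pderiv_dir_eq[OF *(1)] pderiv_dir_eq[OF *(2)]
    by simp
qed

lemma pderiv_dir_const: "pderiv_dir i (\<lambda>x. c) = (\<lambda>x. 0)"
  by (auto simp: pderiv_dir_def)

lemma pderiv_dir_inverse:
  assumes "\<And>x. f differentiable (at x)" "\<And>x. f x \<noteq> 0"
  shows "pderiv_dir i (\<lambda>x. inverse (f x)) =
           (\<lambda>x. pderiv_dir i f x * ((-1) * (inverse (f x) * inverse (f x))))"
proof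
  fix x
  obtain f' where *: "(f has_derivative f') (at x)"
    using assms unfolding differentiable_def by blast
  show "pderiv_dir i (\<lambda>x. inverse (f x)) x =
          pderiv_dir i f x * ((-1) * (inverse (f x) * inverse (f x)))"
    using pderiv_dir_eq[OF Deriv.has_derivative_inverse[OF assms(2) *]] pderiv_dir_eq[OF *]
    by (simp add: mult_ac)
qed

section \<open>Closure properties of \<open>C_k\<close> and iterated partial derivatives\<close>

lemma C_k_const: "C_k k (\<lambda>x. c)"
  by (induction k arbitrary: c) (auto simp: pderiv_dir_const)

lemma C_k_Suc_imp: "C_k (Suc k) f \<Longrightarrow> C_k k f"
proof (induction k arbitrary: f)
  case 0
  thus ?case
    by (auto simp: continuous_on_eq_continuous_at differentiable_imp_continuous_within)
next
  case (Suc k)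
  have "C_k (Suc k) (pderiv_dir i f)" for i using Suc.prems by simp
  from Suc.IH[OF this] show ?case using Suc.prems by simp
qed

lemma C_k_mono: "C_k k f \<Longrightarrow> j \<le> k \<Longrightarrow> C_k j f"
  by (induction k) (auto simp: le_Suc_eq simp del: C_k.simps dest: C_k_Suc_imp)

lemma C_k_continuous: "C_k k f \<Longrightarrow> continuous_on UNIV f"
  using C_k_mono[of k f 0] by simp

lemma C_k_add: "C_k k f \<Longrightarrow> C_k k g \<Longrightarrow> C_k k (\<lambda>x. f x + g x)"
  by (induction k arbitrary: f g) (auto simp: pderiv_dir_add intro!: continuous_on_add)

lemma C_k_mult: "C_k k f \<Longrightarrow> C_k k g \<Longrightarrow> C_k k (\<lambda>x. f x * g x)"
proof (induction k arbitrary: f g)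
  case 0
  thus ?case by (auto intro!: continuous_intros)
next
  case (Suc k)
  have "C_k k f" "C_k k g" using Suc.prems C_k_Suc_imp by blast+
  with Suc show ?case by (auto simp: pderiv_dir_mult intro!: C_k_add Suc.IH)
qed

lemma C_k_inverse: "C_k k f \<Longrightarrow> (\<And>x. f x \<noteq> 0) \<Longrightarrow> C_k k (\<lambda>x. inverse (f x))"
proof (induction k arbitrary: f)
  case 0
  thus ?case by (auto intro!: continuous_intros)
next
  case (Suc k)
  have "C_k k (\<lambda>x. inverse (f x))" using Suc.prems C_k_Suc_imp Suc.IH by blast
  hence "C_k k (\<lambda>x. pderiv_dir i f x * ((-1) * (inverse (f x) * inverse (f x))))" for i
    using Suc.prems(1) by (intro C_k_mult C_k_const) auto
  with Suc.prems show ?case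
    by (auto simp: pderiv_dir_inverse simp del: mult_minus1)
qed

lemma C_k_sum: "(\<And>j. j \<in> J \<Longrightarrow> C_k k (f j)) \<Longrightarrow> C_k k (\<lambda>x. \<Sum>j\<in>J. f j x)"
  by (induction J rule: infinite_finite_induct) (auto intro: C_k_const C_k_add)

lemma C_k_prod: "(\<And>j. j \<in> J \<Longrightarrow> C_k k (f j)) \<Longrightarrow> C_k k (\<lambda>x. \<Prod>j\<in>J. f j x)"
  by (induction J rule: infinite_finite_induct) (auto intro: C_k_const C_k_mult)

lemma C_k_foldr: "C_k (k + length L) f \<Longrightarrow> C_k k (foldr pderiv_dir L f)"
\<comment> \<open>\<open>foldr\<close> applies the last direction of the list first, and
  \<open>C_k\<close> peels off the derivative taken first; hence induction from the end of the
  list.\<close>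
proof (induction L arbitrary: f rule: rev_induct)
  case (snoc i L)
  thus ?case by simp
qed simp

lemma foldr_pderiv_sum:
  assumes "finite J" "\<And>j. j \<in> J \<Longrightarrow> C_k (length L) (f j)"
  shows "foldr pderiv_dir L (\<lambda>x. \<Sum>j\<in>J. f j x) = (\<lambda>x. \<Sum>j\<in>J. foldr pderiv_dir L (f j) x)"
  using assms(2)
proof (induction L arbitrary: f rule: rev_induct)
  case (snoc i L)
  have d: "\<And>j x. j \<in> J \<Longrightarrow> f j differentiable at x" using snoc.prems by simp
  have "pderiv_dir i (\<lambda>x. \<Sum>j\<in>J. f j x) = (\<lambda>x. \<Sum>j\<in>J. pderiv_dir i (f j) x)"
    using assms(1) d
    by (induction J) (auto simp: pderiv_dir_const pderiv_dir_add differentiable_sum)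
  with snoc show ?case by simp
qed simp

lemma pderiv_dir_cong:
  assumes "open U" "x \<in> U" "\<And>y. y \<in> U \<Longrightarrow> f y = g y"
  shows "pderiv_dir i f x = pderiv_dir i g x"
proof -
  have "((\<lambda>t. x + t *\<^sub>R axis i 1) \<longlongrightarrow> x + 0 *\<^sub>R axis i 1) (nhds (0::real))"
    by (intro tendsto_intros filterlim_ident)
  hence "\<forall>\<^sub>F t in nhds (0::real). x + t *\<^sub>R axis i 1 \<in> U"
    using assms(1,2) by (auto dest: topological_tendstoD)
  hence "\<forall>\<^sub>F t in nhds 0. f (x + t *\<^sub>R axis i 1) = g (x + t *\<^sub>R axis i 1)"
    by eventually_elim (rule assms(3))
  thus ?thesis unfolding pderiv_dir_def by (rule deriv_cong_ev) simp
qed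

text \<open>Differentiation is local. This is what allows the cut-off to be dropped where it equals
  1, and it makes derivatives vanish off the support.\<close>

lemma foldr_pderiv_cong:
  assumes "open U" "x \<in> U" "\<And>y. y \<in> U \<Longrightarrow> f y = g y"
  shows "foldr pderiv_dir L f x = foldr pderiv_dir L g x"
  using assms(2)
proof (induction L arbitrary: x)
  case Nil
  thus ?case using assms(3) by simp
next
  case (Cons i L)
  show ?case using pderiv_dir_cong[OF assms(1) Cons.prems Cons.IH] by simp
qed

lemma foldr_pderiv_const: "L \<noteq> [] \<Longrightarrow> foldr pderiv_dir L (\<lambda>x. c) = (\<lambda>x. 0)"
proof (induction L)
  case (Cons i L)
  thus ?case by (cases "L = []") (auto simp: pderiv_dir_const)
qed simp

lemma foldr_pderiv_outside:
  assumes "closed K" "\<And>x. x \<notin> K \<Longrightarrow> f x = 0" "x \<notin> K"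
  shows "foldr pderiv_dir L f x = 0"
  using foldr_pderiv_cong[of "- K" x f "\<lambda>_. 0" L] assms foldr_pderiv_const[of L 0]
  by (cases "L = []") auto

text \<open>The parameter \<open>l\<close> is a frequency: each differentiation may cost a factor \<open>l\<close>.\<close>
fun derivs_bounded :: "nat \<Rightarrow> real \<Rightarrow> real \<Rightarrow> (real ^ 'n::finite \<Rightarrow> real) \<Rightarrow> bool" where
  "derivs_bounded 0 l A f \<longleftrightarrow> (\<forall>x. \<bar>f x\<bar> \<le> A)"
| "derivs_bounded (Suc k) l A f \<longleftrightarrow>
     (\<forall>x. \<bar>f x\<bar> \<le> A) \<and> (\<forall>i. derivs_bounded k l (l * A) (pderiv_dir i f))"

lemma derivs_bounded_bound: "derivs_bounded k l A f \<Longrightarrow> \<bar>f x\<bar> \<le> A"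
  by (cases k) auto

lemma derivs_bounded_Suc_imp: "derivs_bounded (Suc k) l A f \<Longrightarrow> derivs_bounded k l A f"
  by (induction k arbitrary: A f) auto

lemma derivs_bounded_mono:
  "derivs_bounded k l A f \<Longrightarrow> 0 \<le> l \<Longrightarrow> l \<le> m \<Longrightarrow> 0 \<le> A \<Longrightarrow> A \<le> B \<Longrightarrow> derivs_bounded k m B f"
proof (induction k arbitrary: A B f)
  case (Suc k)
  have "l * A \<le> m * B" using Suc.prems by (intro mult_mono) auto
  hence "derivs_bounded k m (m * B) (pderiv_dir i f)" for i
    using Suc.prems by (intro Suc.IH[of "l * A"]) auto
  moreover have "\<bar>f x\<bar> \<le> B" for x using derivs_bounded_bound[OF Suc.prems(1), of x] Suc.prems(5) by linarith
  ultimately show ?case by simp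
next
  case 0
  thus ?case by (simp, meson order_trans)
qed

lemma derivs_bounded_add:
  "C_k k f \<Longrightarrow> C_k k g \<Longrightarrow> derivs_bounded k l A f \<Longrightarrow> derivs_bounded k l B g
    \<Longrightarrow> derivs_bounded k l (A + B) (\<lambda>x. f x + g x)"
proof (induction k arbitrary: A B f g)
  case 0
  have "\<bar>f x + g x\<bar> \<le> A + B" for x
    using 0 abs_triangle_ineq[of "f x" "g x"] by (smt (verit) derivs_bounded.simps(1))
  thus ?case by simp
next
  case (Suc k)
  have "derivs_bounded k l (l * A + l * B) (\<lambda>x. pderiv_dir i f x + pderiv_dir i g x)" for i
    by (rule Suc.IH) (use Suc.prems in auto)
  moreover have "\<bar>f x + g x\<bar> \<le> A + B" for x
    using derivs_bounded_bound[OF Suc.prems(3), of x] derivs_bounded_bound[OF Suc.prems(4), of x]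
    by linarith
  ultimately show ?case using Suc.prems by (simp add: pderiv_dir_add distrib_left)
qed

text \<open>The factor \<open>2 ^ k\<close> is the sum of the binomial coefficients in the Leibniz
  rule: each differentiation turns one product into two.\<close>

lemma derivs_bounded_mult:
  "C_k k f \<Longrightarrow> C_k k g \<Longrightarrow> derivs_bounded k l A f \<Longrightarrow> derivs_bounded k l B g
    \<Longrightarrow> derivs_bounded k l (2 ^ k * A * B) (\<lambda>x. f x * g x)"
proof (induction k arbitrary: A B f g)
  case 0
  have "\<bar>f x\<bar> * \<bar>g x\<bar> \<le> A * B" for x
    using 0 abs_ge_zero[of "f x"] by (intro mult_mono) (auto intro: order_trans)
  thus ?case by (simp add: abs_mult)
next
  case (Suc k)
  have A: "0 \<le> A" "0 \<le> B"
    using derivs_bounded_bound[OF Suc.prems(3), of 0] derivs_bounded_bound[OF Suc.prems(4), of 0]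
    by linarith+
  have 1: "\<bar>f x * g x\<bar> \<le> 2 ^ Suc k * A * B" for x
  proof -
    have "\<bar>f x * g x\<bar> \<le> 1 * (A * B)"
      using Suc.prems A by (auto simp: abs_mult intro!: mult_mono)
    also have "\<dots> \<le> 2 ^ Suc k * (A * B)"
      using A by (intro mult_right_mono) (auto simp del: power_Suc intro!: one_le_power)
    finally show ?thesis by (simp add: mult_ac)
  qed
  have 2: "derivs_bounded k l (l * (2 ^ Suc k * A * B)) (pderiv_dir i (\<lambda>x. f x * g x))" for i
  proof -
    note C = Suc.prems(1,2)[THEN C_k_Suc_imp] Suc.prems(3,4)[THEN derivs_bounded_Suc_imp]
    have D: "C_k k (pderiv_dir i f)" "C_k k (pderiv_dir i g)"
      "derivs_bounded k l (l * A) (pderiv_dir i f)" "derivs_bounded k l (l * B) (pderiv_dir i g)"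
      using Suc.prems by auto
    have "derivs_bounded k l (2 ^ k * (l * A) * B + 2 ^ k * A * (l * B))
            (\<lambda>x. pderiv_dir i f x * g x + f x * pderiv_dir i g x)"
      by (intro derivs_bounded_add C_k_mult Suc.IH C D)
    moreover have "2 ^ k * (l * A) * B + 2 ^ k * A * (l * B) = l * (2 ^ Suc k * A * B)" by simp
    ultimately show ?thesis using Suc.prems by (simp add: pderiv_dir_mult)
  qed
  show ?case using 1 2 by simp
qed

lemma derivs_bounded_foldr:
  "derivs_bounded k l A f \<Longrightarrow> length L \<le> k \<Longrightarrow> \<bar>foldr pderiv_dir L f x\<bar> \<le> l ^ length L * A"
proof (induction L arbitrary: k A f rule: rev_induct)
  case Nil
  thus ?case by (simp add: derivs_bounded_bound)
next
  case (snoc i L)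
  then obtain j where k: "k = Suc j" by (cases k) auto
  hence "derivs_bounded j l (l * A) (pderiv_dir i f)" using snoc.prems by simp
  from snoc.IH[OF this] show ?case using snoc.prems k by (simp add: mult_ac)
qed

text \<open>Derivatives stay supported in \<open>K\<close>, where continuity gives boundedness. With
  frequency 1 the bound is the same at every order up to \<open>k\<close>.\<close>

lemma derivs_bounded_compact_support:
  fixes f :: "real ^ 'n::finite \<Rightarrow> real"
  assumes "compact K"
  shows "C_k k f \<Longrightarrow> (\<And>x. x \<notin> K \<Longrightarrow> f x = 0) \<Longrightarrow> \<exists>A\<ge>0. derivs_bounded k 1 A f"
proof (induction k arbitrary: f)
  have bd: "\<exists>B\<ge>0. \<forall>x. \<bar>f x\<bar> \<le> B" if "continuous_on UNIV f" "\<And>x. x \<notin> K \<Longrightarrow> f x = 0"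
    for f :: "real ^ 'n \<Rightarrow> real"
  proof -
    have "bounded (f ` K)"
      using compact_continuous_image[OF continuous_on_subset[OF that(1)] assms]
      by (auto intro: compact_imp_bounded)
    then obtain B where B: "\<And>x. x \<in> K \<Longrightarrow> \<bar>f x\<bar> \<le> B" by (auto simp: bounded_iff)
    have "\<bar>f x\<bar> \<le> max B 0" for x using B that(2) by (cases "x \<in> K") (auto simp: le_max_iff_disj)
    thus ?thesis by (intro exI[of _ "max B 0"]) auto
  qed
  case 0
  thus ?case using bd by auto
next
  case (Suc k)
  have bd: "\<exists>B\<ge>0. derivs_bounded k 1 B f"
    using Suc.IH[of f] Suc.prems C_k_Suc_imp by blast
  have "\<exists>B\<ge>0. derivs_bounded k 1 B (pderiv_dir i f)" for i
  proof (rule Suc.IH)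
    show "C_k k (pderiv_dir i f)" using Suc.prems by simp
    show "pderiv_dir i f x = 0" if "x \<notin> K" for x
      using foldr_pderiv_outside[of K f x "[i]"] that assms Suc.prems(2)
      by (auto simp: compact_imp_closed)
  qed
  then obtain B where B: "\<And>i. B i \<ge> 0" "\<And>i. derivs_bounded k 1 (B i) (pderiv_dir i f)" by metis
  obtain B0 where B0: "B0 \<ge> 0" "derivs_bounded k 1 B0 f" using bd by blast
  \<comment> \<open>One constant has to serve the function and all directions at once; the sum of
    the nonnegative bounds dominates each of them.\<close>
  let ?B = "B0 + (\<Sum>i\<in>UNIV. B i)"
  have "B i \<le> ?B" for i using B(1) B0(1) member_le_sum[of i UNIV B] by auto
  hence "derivs_bounded k 1 (1 * ?B) (pderiv_dir i f)" for i
    using derivs_bounded_mono[OF B(2)[of i], of 1 ?B] B(1)[of i] by simp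
  moreover have "\<bar>f x\<bar> \<le> ?B" for x
    using derivs_bounded_bound[OF B0(2), of x] sum_nonneg[of UNIV B] B(1) by force
  ultimately show ?case using B(1) B0(1) by (intro exI[of _ ?B]) (auto intro!: sum_nonneg add_nonneg_nonneg)
qed

text \<open>Expanding a vector in the standard basis bounds the operator norm of the derivative by
  \<open>n * B\<close>, and the mean value inequality on the whole space does the rest. The
  dimensional factor is crude but harmless.\<close>

lemma C_k_1_lipschitz:
  fixes f :: "real ^ 'n::finite \<Rightarrow> real"
  assumes "C_k 1 f" "\<And>i x. \<bar>pderiv_dir i f x\<bar> \<le> B"
  shows "\<bar>f x - f y\<bar> \<le> real CARD('n) * B * norm (x - y)"
proof -
  obtain f' where f': "\<And>x. (f has_derivative f' x) (at x)"
    using assms(1) unfolding differentiable_def One_nat_def C_k.simps by metis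
  have "onorm (f' x) \<le> real CARD('n) * B" for x
  proof (rule onorm_le)
    fix v :: "real ^ 'n"
    have "f' x v = f' x (\<Sum>i\<in>UNIV. (v $ i) *\<^sub>R axis i 1)"
      by (simp add: basis_expansion flip: scalar_mult_eq_scaleR)
    also have "\<dots> = (\<Sum>i\<in>UNIV. (v $ i) * pderiv_dir i f x)"
      using f'[of x, THEN has_derivative_bounded_linear] pderiv_dir_eq[OF f']
      by (simp add: linear_sum[OF bounded_linear.linear] linear_simps(5))
    finally have "norm (f' x v) \<le> (\<Sum>i\<in>UNIV. \<bar>(v $ i) * pderiv_dir i f x\<bar>)" by simp
    also have "\<dots> \<le> (\<Sum>i\<in>(UNIV::'n set). norm v * B)"
      using assms(2) by (intro sum_mono) (auto simp: abs_mult component_le_norm_cart intro!: mult_mono)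
    finally show "norm (f' x v) \<le> real CARD('n) * B * norm v" by (simp add: mult_ac)
  qed
  from differentiable_bound[OF convex_UNIV has_derivative_at_withinI[OF f'] this, of x y]
  show ?thesis by simp
qed

subsection \<open>Smooth bump functions\<close>

text \<open>The powers of 1/t are carried along because differentiation maps this family into its
  own linear combinations, so that smoothness follows by one induction over all \<open>m\<close>
  simultaneously.\<close>

definition exp_inv :: "nat \<Rightarrow> real \<Rightarrow> real" where
  "exp_inv m t = (if t > 0 then exp (- inverse t) * inverse t ^ m else 0)"

lemma exp_inv_nonneg: "exp_inv m t \<ge> 0"
  by (auto simp: exp_inv_def)

lemma exp_inv_tendsto_0: "(exp_inv m \<longlongrightarrow> 0) (at 0)"
proof (rule filterlim_split_at)
  show "(exp_inv m \<longlongrightarrow> 0) (at_left 0)"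
    by (rule tendsto_eventually)
       (auto simp: exp_inv_def eventually_at_filter)
  have "((\<lambda>t. inverse t ^ m / exp (inverse t)) \<longlongrightarrow> 0) (at_right (0::real))"
    by (rule filterlim_compose[OF tendsto_power_div_exp_0 filterlim_inverse_at_top_right])
  moreover have "\<forall>\<^sub>F t in at_right 0. inverse t ^ m / exp (inverse t) = exp_inv m t"
    by (auto simp: exp_inv_def eventually_at_filter exp_minus field_simps)
  ultimately show "(exp_inv m \<longlongrightarrow> 0) (at_right 0)"
    by (rule Lim_transform_eventually)
qed

lemma exp_inv_derivative:
  "(exp_inv m has_real_derivative exp_inv (m + 2) t - real m * exp_inv (m + 1) t) (at t)"
proof -
  consider "t > 0" | "t < 0" | "t = 0" by linarith
  thus ?thesis
  proof cases
    case 1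
    have "((\<lambda>t. exp (- inverse t) * inverse t ^ m) has_real_derivative
            exp_inv (m + 2) t - real m * exp_inv (m + 1) t) (at t)"
    proof (cases m)
      case (Suc n)
      have "t * t ^ (n - Suc 0) = (if n = 0 then t else t ^ n)" by (cases n) auto
      with 1 Suc show ?thesis
        by (auto intro!: derivative_eq_intros simp: exp_inv_def field_simps power2_eq_square)
    qed (use 1 in \<open>auto intro!: derivative_eq_intros simp: exp_inv_def field_simps power2_eq_square\<close>)
    thus ?thesis
      by (rule has_field_derivative_transform_within_open[where S = "{0<..}"])
         (use 1 in \<open>auto simp: exp_inv_def\<close>)
  next
    case 2
    have "((\<lambda>t. 0) has_real_derivative exp_inv (m + 2) t - real m * exp_inv (m + 1) t) (at t)"
      using 2 by (simp add: exp_inv_def)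
    thus ?thesis
      by (rule has_field_derivative_transform_within_open[where S = "{..<0}"])
         (use 2 in \<open>auto simp: exp_inv_def\<close>)
  next
    case 3
    \<comment> \<open>The difference quotient at 0 is again a member of the family, so its limit is
      already known; the claimed derivative is 0 there because every \<open>exp_inv\<close> vanishes
      at 0.\<close>
    have "(\<lambda>h. (exp_inv m (0 + h) - exp_inv m 0) / h) = exp_inv (m + 1)"
      by (auto simp: exp_inv_def fun_eq_iff field_simps)
    thus ?thesis using 3 exp_inv_tendsto_0[of "m + 1"]
      by (simp add: DERIV_def exp_inv_def[of _ 0])
  qed
qed

lemma affine_coord_derivative:
  fixes x :: "real ^ 'n::finite"
  assumes "(h has_real_derivative D) (at (c + d * x $ i))"
  shows "(\<lambda>x. h (c + d * x $ i)) differentiable (at x)"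
    and "pderiv_dir j (\<lambda>x. h (c + d * x $ i)) x = (if i = j then d else 0) * D"
proof -
  have "((\<lambda>x. c + d * x $ i) has_derivative (\<lambda>v. d * v $ i)) (at x)"
    by (auto intro!: derivative_eq_intros bounded_linear.has_derivative[OF bounded_linear_vec_nth])
  from has_derivative_compose[OF this, of h "(*) D"] assms
  have *: "((\<lambda>x. h (c + d * x $ i)) has_derivative (\<lambda>v. D * (d * v $ i))) (at x)"
    by (simp add: has_field_derivative_def)
  show "(\<lambda>x. h (c + d * x $ i)) differentiable (at x)"
    using * unfolding differentiable_def by blast
  show "pderiv_dir j (\<lambda>x. h (c + d * x $ i)) x = (if i = j then d else 0) * D"
    using pderiv_dir_eq[OF *, of j] by (auto simp: axis_def)
qed

lemma C_k_exp_inv_affine: "C_k k (\<lambda>x :: real ^ 'n::finite. exp_inv m (c + d * x $ i))"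
proof (induction k arbitrary: m)
  case 0
  show ?case
    using affine_coord_derivative(1)[OF exp_inv_derivative]
    by (auto simp: continuous_on_eq_continuous_at intro!: differentiable_imp_continuous_within)
next
  case (Suc k)
  have "pderiv_dir j (\<lambda>x :: real ^ 'n. exp_inv m (c + d * x $ i)) =
      (\<lambda>x. (if i = j then d else 0) *
             (exp_inv (m + 2) (c + d * x $ i) + - real m * exp_inv (m + 1) (c + d * x $ i)))" for j
    using affine_coord_derivative(2)[OF exp_inv_derivative] by fastforce
  moreover have "C_k k (\<lambda>x :: real ^ 'n. (if i = j then d else 0) *
      (exp_inv (m + 2) (c + d * x $ i) + - real m * exp_inv (m + 1) (c + d * x $ i)))" for j
    by (intro C_k_add C_k_mult C_k_const Suc.IH)
  moreover have "(\<lambda>x :: real ^ 'n. exp_inv m (c + d * x $ i)) differentiable (at x)" for x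
    by (rule affine_coord_derivative(1)[OF exp_inv_derivative])
  ultimately show ?case by simp
qed

definition smooth_step :: "real \<Rightarrow> real" where
  "smooth_step t = exp_inv 0 t * inverse (exp_inv 0 t + exp_inv 0 (1 - t))"

lemma smooth_step_pos: "exp_inv 0 t + exp_inv 0 (1 - t) > 0"
  by (cases "t > 0") (auto simp: exp_inv_def add_pos_nonneg)

lemma smooth_step_0: "t \<le> 0 \<Longrightarrow> smooth_step t = 0"
  and smooth_step_1: "t \<ge> 1 \<Longrightarrow> smooth_step t = 1"
  by (auto simp: smooth_step_def exp_inv_def)

lemma smooth_step_range: "0 \<le> smooth_step t" "smooth_step t \<le> 1"
  using smooth_step_pos[of t] exp_inv_nonneg[of 0 t] exp_inv_nonneg[of 0 "1 - t"]
  by (auto simp: smooth_step_def field_simps)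

lemma C_k_smooth_step_affine: "C_k k (\<lambda>x :: real ^ 'n::finite. smooth_step (c + d * x $ i))"
proof -
  have "C_k k (\<lambda>x :: real ^ 'n. exp_inv 0 (c + d * x $ i) *
      inverse (exp_inv 0 (c + d * x $ i) + exp_inv 0 ((1 - c) + (- d) * x $ i)))"
    by (intro C_k_mult C_k_inverse C_k_add C_k_exp_inv_affine)
       (metis add_uminus_conv_diff diff_diff_eq mult_minus_left order_less_irrefl smooth_step_pos
         diff_conv_add_uminus)
  thus ?thesis by (simp add: smooth_step_def algebra_simps)
qed

text \<open>The steepness \<open>l\<close> makes the transition layer along the faces 1/l wide. The
  value \<open>l = 1\<close> gives the cut-off \<psi>; letting \<open>l\<close> tend to infinity
  approximates the indicator of the open box by test functions.\<close>

definition box_bump :: "real \<Rightarrow> real ^ 'n \<Rightarrow> real ^ 'n \<Rightarrow> real ^ 'n::finite \<Rightarrow> real" where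
  "box_bump l a b x = (\<Prod>i\<in>UNIV. smooth_step (l * (x $ i - a $ i)) * smooth_step (l * (b $ i - x $ i)))"

lemma C_k_box_bump: "C_k k (box_bump l a b)"
proof -
  have "C_k k (\<lambda>x. \<Prod>i\<in>UNIV. smooth_step ((- l * a $ i) + l * x $ i) * smooth_step (l * b $ i + (- l) * x $ i))"
    by (intro C_k_prod C_k_mult C_k_smooth_step_affine)
  thus ?thesis by (simp add: box_bump_def[abs_def] algebra_simps)
qed

lemma box_bump_0:
  assumes "l \<ge> 0" "x \<notin> box a b"
  shows "box_bump l a b x = 0"
proof -
  obtain i where "x $ i \<le> a $ i \<or> b $ i \<le> x $ i" using assms(2) by (auto simp: mem_box_cart not_less)
  hence "smooth_step (l * (x $ i - a $ i)) * smooth_step (l * (b $ i - x $ i)) = 0"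
    using assms(1) by (auto simp: smooth_step_0 mult_nonneg_nonpos)
  thus ?thesis unfolding box_bump_def by (meson UNIV_I finite prod_zero)
qed

lemma box_bump_1:
  assumes "\<And>i. 1 \<le> l * (x $ i - a $ i)" "\<And>i. 1 \<le> l * (b $ i - x $ i)"
  shows "box_bump l a b x = 1"
  using assms by (simp add: box_bump_def smooth_step_1)

lemma box_bump_range: "0 \<le> box_bump l a b x" "box_bump l a b x \<le> 1"
  by (auto simp: box_bump_def smooth_step_range intro!: prod_nonneg prod_le_1 mult_le_one)

lemma test_functionI:
  assumes "\<And>k. C_k k f" "\<And>x. x \<notin> cbox a b \<Longrightarrow> f x = 0"
  shows "test_function f"
proof -
  have "closure {x. f x \<noteq> 0} \<subseteq> cbox a b"
    using assms(2) by (intro closure_minimal) auto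
  thus ?thesis using assms(1) unfolding test_function_def
    by (metis closed_closure compact_Int_closed compact_cbox inf.absorb_iff2)
qed

lemma test_function_box_bump: "l \<ge> 0 \<Longrightarrow> test_function (box_bump l a b)"
  by (rule test_functionI[OF C_k_box_bump]) (use box_bump_0 box_subset_cbox in blast)

lemma box_bump_tendsto_indicator:
  "(\<lambda>m. box_bump (real m) a b x) \<longlonglongrightarrow> indicator (box a b) x"
proof (cases "x \<in> box a b")
  case True
  have ev: "\<forall>\<^sub>F m in sequentially. 1 \<le> real m * c" if "c > 0" for c
  proof -
    have "filterlim (\<lambda>m. real m * c) at_top sequentially"
      using that by (intro filterlim_at_top_mult_tendsto_pos[OF tendsto_const] filterlim_real_sequentially)
    thus ?thesis by (auto simp: filterlim_at_top)
  qed
  have "\<forall>\<^sub>F m in sequentially. \<forall>i. 1 \<le> real m * (x $ i - a $ i) \<and> 1 \<le> real m * (b $ i - x $ i)"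
    using True by (intro eventually_all_finite eventually_conj ev) (auto simp: mem_box_cart)
  hence "\<forall>\<^sub>F m in sequentially. box_bump (real m) a b x = indicator (box a b) x"
    by eventually_elim (use True in \<open>auto intro!: box_bump_1\<close>)
  thus ?thesis by (rule tendsto_eventually)
next
  case False
  thus ?thesis by (simp add: box_bump_0)
qed

lemma test_function_compact_support:
  assumes "test_function f"
  obtains K where "compact K" "\<And>x. x \<notin> K \<Longrightarrow> f x = 0"
  using assms unfolding test_function_def by (metis (mono_tags, lifting) closure_subset mem_Collect_eq subsetD)

subsection \<open>Weak derivatives of smooth functions\<close>

lemma integrable_compact_support:
  fixes f :: "real ^ 'n::finite \<Rightarrow> real"
  assumes "continuous_on UNIV f" "compact K" "\<And>x. x \<notin> K \<Longrightarrow> f x = 0"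
  shows "integrable lborel f"
proof -
  have "(\<lambda>x. indicator K x *\<^sub>R f x) = f" using assms(3) by (auto simp: indicator_def fun_eq_iff)
  thus ?thesis
    using borel_integrable_compact[OF assms(2) continuous_on_subset[OF assms(1) subset_UNIV]] by simp
qed

lemma integral_translation:
  fixes f :: "real ^ 'n::finite \<Rightarrow> real"
  assumes "f \<in> borel_measurable borel"
  shows "(LINT x|lborel. f (x + c)) = (LINT x|lborel. f x)"
proof -
  have "(LINT x|lborel. f x) = (LINT x|distr lborel borel ((+) c). f x)"
    by (simp add: lborel_distr_plus)
  also have "\<dots> = (LINT x|lborel. f (c + x))"
    using assms by (intro integral_distr) auto
  finally show ?thesis by (simp add: add.commute)
qed

lemma pderiv_dir_has_derivative:
  assumes "f differentiable (at x)"
  shows "((\<lambda>t. f (x + t *\<^sub>R axis i 1)) has_real_derivative pderiv_dir i f x) (at 0)"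
proof -
  obtain f' where "(f has_derivative f') (at x)" using assms by (auto simp: differentiable_def)
  thus ?thesis using has_derivative_along_axis pderiv_dir_eq by metis
qed

text \<open>By translation invariance the integrals of all difference quotients of \<open>g\<close> vanish.\<close>
lemma integral_pderiv_dir_eq_0:
  fixes g :: "real ^ 'n::finite \<Rightarrow> real"
  assumes C: "C_k 1 g" and K: "compact K" "\<And>x. x \<notin> K \<Longrightarrow> g x = 0"
  shows "(LINT x|lborel. pderiv_dir i g x) = 0"
proof -
  obtain A where "derivs_bounded 1 1 A g"
    using derivs_bounded_compact_support[OF K(1) C K(2)] by blast
  hence A: "\<bar>pderiv_dir i g x\<bar> \<le> A" for i x by simp
  obtain R where R: "K \<subseteq> cball 0 R" 
    using compact_imp_bounded[OF K(1)] unfolding bounded_pos by (auto simp: subset_iff)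
  define h where "h m = inverse (real (Suc m))" for m
  define q where "q m x = (g (x + h m *\<^sub>R axis i 1) - g x) / h m" for m x
  define L where "L = real CARD('n) * A"
  have h: "0 < h m" "h m \<le> 1" for m by (auto simp: h_def field_simps)
  have cont: "continuous_on UNIV g" using C C_k_continuous by blast
  hence [measurable]: "g \<in> borel_measurable borel"
    by (simp add: borel_measurable_continuous_onI)
  have cont': "continuous_on UNIV (pderiv_dir i g)" using C by simp
  hence [measurable]: "pderiv_dir i g \<in> borel_measurable borel"
    by (simp add: borel_measurable_continuous_onI)
  have [measurable]: "q m \<in> borel_measurable borel" for m unfolding q_def by measurable
  have int: "integrable lborel g" by (rule integrable_compact_support[OF cont K])
  have int': "integrable lborel (\<lambda>x. g (x + c))" for c
  proof (rule integrable_compact_support)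
    show "continuous_on UNIV (\<lambda>x. g (x + c))"
      using cont by (auto intro!: continuous_on_compose2[OF cont] continuous_intros)
    show "compact ((\<lambda>x. x - c) ` K)" using K(1) by (rule compact_translation_subtract)
    show "g (x + c) = 0" if "x \<notin> (\<lambda>x. x - c) ` K" for x
    proof (rule K(2))
      show "x + c \<notin> K" using that by (metis add_diff_cancel image_eqI)
    qed
  qed
  have "(LINT x|lborel. q m x) = 0" for m
    unfolding q_def using int int' by (simp add: integral_translation)
  moreover have "(\<lambda>m. LINT x|lborel. q m x) \<longlonglongrightarrow> (LINT x|lborel. pderiv_dir i g x)"
  proof (rule integral_dominated_convergence)
    \<comment> \<open>All steps \<open>h m\<close> are at most 1, so the difference quotients are
      supported in a ball of radius \<open>R + 1\<close>, and the Lipschitz constant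
      \<open>L\<close> bounds them there.\<close>
    show "integrable lborel (\<lambda>x :: real ^ 'n. indicator (cball 0 (R + 1)) x * L)"
      using borel_integrable_compact[of "cball 0 (R + 1)" "\<lambda>_::real^'n. L"] by simp
    show "AE x in lborel. (\<lambda>m. q m x) \<longlonglongrightarrow> pderiv_dir i g x"
    proof (rule AE_I2)
      fix x
      have "((\<lambda>t. (g (x + t *\<^sub>R axis i 1) - g x) / t) \<longlongrightarrow> pderiv_dir i g x) (at 0)"
        using pderiv_dir_has_derivative[of g x i] C by (simp add: DERIV_def)
      moreover have "filterlim h (at 0) sequentially"
        unfolding h_def using h(1) LIMSEQ_inverse_real_of_nat
        by (auto simp: filterlim_at h_def)
      ultimately show "(\<lambda>m. q m x) \<longlonglongrightarrow> pderiv_dir i g x"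
        unfolding q_def by (rule filterlim_compose)
    qed
    show "AE x in lborel. norm (q m x) \<le> indicator (cball 0 (R + 1)) x * L" for m
    proof (rule AE_I2)
      fix x
      show "norm (q m x) \<le> indicator (cball 0 (R + 1)) x * L"
      proof (cases "x \<in> cball 0 (R + 1)")
        case True
        have "\<bar>g (x + h m *\<^sub>R axis i 1) - g x\<bar> \<le> L * norm (x + h m *\<^sub>R axis i 1 - x)"
          unfolding L_def by (rule C_k_1_lipschitz[OF C A])
        also have "norm (x + h m *\<^sub>R axis i 1 - x) = h m" using h(1)[of m] by simp
        finally show ?thesis using True h(1)[of m] by (simp add: q_def field_simps)
      next
        case False
        have "norm x \<le> norm (x + h m *\<^sub>R axis i 1) + norm (h m *\<^sub>R (axis i 1 :: real^'n))"
          by (metis add_diff_cancel norm_triangle_ineq4)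
        hence "norm (x + h m *\<^sub>R axis i 1) > R" using False h[of m] by simp
        hence "x + h m *\<^sub>R axis i 1 \<notin> K" "x \<notin> K" using R False by auto
        thus ?thesis using False by (simp add: q_def K(2))
      qed
    qed
  qed auto
  ultimately show ?thesis by (simp add: LIMSEQ_const_iff)
qed

lemma integral_by_parts_dir:
  fixes f g :: "real ^ 'n::finite \<Rightarrow> real"
  assumes C: "C_k 1 f" "C_k 1 g" and K: "compact K" "\<And>x. x \<notin> K \<Longrightarrow> g x = 0"
  shows "(LINT x|lborel. f x * pderiv_dir i g x) = - (LINT x|lborel. pderiv_dir i f x * g x)"
proof -
  have cont: "continuous_on UNIV f" "continuous_on UNIV g"
    "continuous_on UNIV (pderiv_dir i f)" "continuous_on UNIV (pderiv_dir i g)"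
    using C C_k_continuous[OF C(1)] C_k_continuous[OF C(2)] by auto
  have K': "x \<notin> K \<Longrightarrow> pderiv_dir i g x = 0" for x
    using foldr_pderiv_outside[of K g x "[i]"] K compact_imp_closed by auto
  have "0 = (LINT x|lborel. pderiv_dir i (\<lambda>x. f x * g x) x)"
    by (rule integral_pderiv_dir_eq_0[OF _ K(1), symmetric])
       (use C K C_k_mult[of 1 f g] in auto)
  also have "pderiv_dir i (\<lambda>x. f x * g x) = (\<lambda>x. pderiv_dir i f x * g x + f x * pderiv_dir i g x)"
    using C by (intro pderiv_dir_mult) auto
  also have "(LINT x|lborel. \<dots> x) =
      (LINT x|lborel. pderiv_dir i f x * g x) + (LINT x|lborel. f x * pderiv_dir i g x)"
    by (intro Bochner_Integration.integral_add integrable_compact_support[OF _ K(1)]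
        continuous_on_mult cont) (auto simp: K K')
  finally show ?thesis by simp
qed

lemma integral_by_parts:
  fixes f g :: "real ^ 'n::finite \<Rightarrow> real"
  assumes "C_k (length L) f" "\<And>k. C_k k g" and K: "compact K" "\<And>x. x \<notin> K \<Longrightarrow> g x = 0"
  shows "(LINT x|lborel. f x * foldr pderiv_dir L g x) =
         (-1) ^ length L * (LINT x|lborel. foldr pderiv_dir (rev L) f x * g x)"
  using assms(1)
proof (induction L arbitrary: f)
  case (Cons i L)
  have "C_k 1 f" using Cons.prems by (rule C_k_mono) simp
  hence "(LINT x|lborel. f x * pderiv_dir i (foldr pderiv_dir L g) x) =
      - (LINT x|lborel. pderiv_dir i f x * foldr pderiv_dir L g x)"
    by (rule integral_by_parts_dir[OF _ C_k_foldr K(1)])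
       (use assms(2) foldr_pderiv_outside[OF compact_imp_closed[OF K(1)], of g] K(2) in auto)
  also have "(LINT x|lborel. pderiv_dir i f x * foldr pderiv_dir L g x) =
      (-1) ^ length L * (LINT x|lborel. foldr pderiv_dir (rev L) (pderiv_dir i f) x * g x)"
    by (rule Cons.IH) (use Cons.prems in simp)
  finally show ?case by simp
qed simp

text \<open>Flattening a multi-index into a list of directions gives every iterated derivative the
  form \<open>foldr pderiv_dir L\<close>, on which all inductions are carried out.\<close>

definition mi_list :: "('n::finite) multi_index \<Rightarrow> 'n list" where
  "mi_list \<nu> = concat (map (\<lambda>i. replicate (\<nu> i) i) coords)"

lemma mi_deriv_eq_foldr: "mi_deriv \<nu> f = foldr pderiv_dir (mi_list \<nu>) f"
proof -
  have "foldr (\<lambda>i. pderiv_dir i ^^ \<nu> i) xs f =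
      foldr pderiv_dir (concat (map (\<lambda>i. replicate (\<nu> i) i) xs)) f" for xs
    by (induction xs) auto
  thus ?thesis by (simp add: mi_deriv_def mi_list_def)
qed

lemma length_mi_list: "length (mi_list \<nu>) = mi_order \<nu>"
proof -
  have "length (mi_list \<nu>) = sum_list (map \<nu> coords)"
    by (simp add: mi_list_def length_concat o_def)
  thus ?thesis by (simp add: mi_order_def sum_list_distinct_conv_sum_set coords)
qed

lemma locally_integrable_continuous:
  assumes "continuous_on UNIV f" shows "locally_integrable f"
  unfolding locally_integrable_def set_integrable_def
proof safe
  fix K :: "(real ^ 'a) set" assume "compact K"
  from borel_integrable_compact[OF this continuous_on_subset[OF assms subset_UNIV]]
  show "integrable lebesgue (\<lambda>x. indicat_real K x *\<^sub>R f x)"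
    by (subst integrable_completion) (auto dest: borel_measurable_integrable)
qed

text \<open>
  Integrating by parts moves the partial derivatives over in reversed order; keeping that order makes
  the symmetry of higher derivatives unnecessary.
\<close>
lemma has_weak_deriv_classical:
  fixes f :: "real ^ 'n::finite \<Rightarrow> real"
  assumes "C_k (mi_order \<nu>) f"
  shows "has_weak_deriv \<nu> f (foldr pderiv_dir (rev (mi_list \<nu>)) f)"
proof -
  let ?D = "foldr pderiv_dir (rev (mi_list \<nu>)) f"
  have cont: "continuous_on UNIV f" "continuous_on UNIV ?D"
    using C_k_continuous[OF assms] C_k_continuous[OF C_k_foldr[of 0 "rev (mi_list \<nu>)" f]] assms
    by (auto simp: length_mi_list)
  have "(LINT x|lebesgue. f x * mi_deriv \<nu> \<phi> x) = (-1) ^ mi_order \<nu> * (LINT x|lebesgue. ?D x * \<phi> x)"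
    if \<phi>: "test_function \<phi>" for \<phi>
  proof -
    obtain K where K: "compact K" "\<And>x. x \<notin> K \<Longrightarrow> \<phi> x = 0" using test_function_compact_support[OF \<phi>] by blast
    have C: "C_k k \<phi>" for k using \<phi> by (simp add: test_function_def)
    have "continuous_on UNIV \<phi>" "continuous_on UNIV (mi_deriv \<nu> \<phi>)"
      unfolding mi_deriv_eq_foldr using C C_k_continuous C_k_foldr by blast+
    with cont have [measurable]: "f \<in> borel_measurable borel" "?D \<in> borel_measurable borel"
      "\<phi> \<in> borel_measurable borel" "mi_deriv \<nu> \<phi> \<in> borel_measurable borel"
      by (auto intro: borel_measurable_continuous_onI)
    show ?thesis
      using integral_by_parts[of "mi_list \<nu>" f \<phi> K] C K assms
      by (simp add: integral_completion mi_deriv_eq_foldr[symmetric] length_mi_list)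
  qed
  thus ?thesis using cont by (simp add: has_weak_deriv_def locally_integrable_continuous)
qed

text \<open>A Dynkin argument: boxes form an intersection-stable generator of the Borel sets, and
  the sets over which \<open>w\<close> integrates to 0 are closed under disjoint unions and, because
  of \<open>total\<close>, under complements.\<close>

lemma AE_0_if_box_integrals_0:
  fixes w :: "real ^ 'n::finite \<Rightarrow> real"
  assumes w: "integrable lborel w" and box: "\<And>a b. (LINT x:box a b|lborel. w x) = 0"
    and total: "(LINT x|lborel. w x) = 0"
  shows "AE x in lborel. w x = 0"
proof (rule density_unique_real[OF w])
  show "integrable lborel (\<lambda>x::real^'n. 0::real)" by simp
  fix A :: "(real ^ 'n) set" assume "A \<in> sets lborel"
  let ?G = "range (\<lambda>(a, b). box a b :: (real ^ 'n) set)"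
  have sets: "sets lborel = sigma_sets UNIV ?G"
    by (simp add: borel_eq_box[where 'a = "real ^ 'n"])
  have sw: "set_integrable lborel A w" if "A \<in> sets lborel" for A
    using w that unfolding set_integrable_def by (intro integrable_mult_indicator)
  have "Int_stable ?G"
    by (auto simp: Int_stable_def box_Int_box)
  moreover have "?G \<subseteq> Pow UNIV" by simp
  moreover have "A \<in> sigma_sets UNIV ?G" using \<open>A \<in> sets lborel\<close> sets by simp
  ultimately have "(LINT x:A|lborel. w x) = 0"
  proof (induction rule: sigma_sets_induct_disjoint)
    case (compl A)
    have A: "A \<in> sets lborel" using compl sets by simp
    have "(LINT x:A \<union> (UNIV - A)|lborel. w x) = (LINT x:A|lborel. w x) + (LINT x:UNIV - A|lborel. w x)"
      using A by (intro set_integral_Un sw) auto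
    thus ?case using compl total by (simp add: set_lebesgue_integral_def)
  next
    case (union A)
    have A: "A i \<in> sets lborel" for i using union sets by auto
    have "(LINT x:(\<Union>i. A i)|lborel. w x) = (\<Sum>i. (LINT x:(A i)|lborel. w x))"
      using A union(1) by (intro lebesgue_integral_countable_add sw) (auto simp: disjoint_family_on_def)
    thus ?case using union by simp
  qed (use box in \<open>auto simp: set_lebesgue_integral_def\<close>)
  thus "(LINT x:A|lborel. w x) = (LINT x:A|lborel. 0)" by (simp add: set_lebesgue_integral_def)
qed

text \<open>The fundamental lemma of the calculus of variations. Test functions converging to
  indicators of boxes show that \<open>w\<close> has integral 0 over every box, which determines it
  up to a null set.\<close>

lemma test_function_AE_0:
  fixes w :: "real ^ 'n::finite \<Rightarrow> real"
  assumes w: "locally_integrable w"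
    and 0: "\<And>\<phi>. test_function \<phi> \<Longrightarrow> (LINT x|lebesgue. w x * \<phi> x) = 0"
  shows "AE x in lebesgue. w x = 0"
proof -
  have box0: "(LINT x|lebesgue. indicator (box a b) x * w x) = 0" for a b
  proof -
    \<comment> \<open>The bumps live in the closed box, so inserting its indicator changes nothing
      and supplies an integrable majorant for the merely locally integrable
      \<open>w\<close>.\<close>
    have "(\<lambda>m. LINT x|lebesgue. (indicator (cbox a b) x *\<^sub>R w x) * box_bump (real m) a b x)
        \<longlonglongrightarrow> (LINT x|lebesgue. (indicator (cbox a b) x *\<^sub>R w x) * indicator (box a b) x)"
    proof (rule integral_dominated_convergence)
      have int: "integrable lebesgue (\<lambda>x. indicator (cbox a b) x *\<^sub>R w x)"
        using w by (simp add: locally_integrable_def set_integrable_def)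
      thus "integrable lebesgue (\<lambda>x. \<bar>indicator (cbox a b) x *\<^sub>R w x\<bar>)" by simp
      have m[measurable]: "(\<lambda>x. indicator (cbox a b) x *\<^sub>R w x) \<in> borel_measurable lebesgue"
        using int by (rule borel_measurable_integrable)
      have "box a b \<in> sets lebesgue" by simp
      thus "(\<lambda>x. (indicator (cbox a b) x *\<^sub>R w x) * indicator (box a b) x) \<in> borel_measurable lebesgue"
        by (intro borel_measurable_times m borel_measurable_indicator)
      have "box_bump (real k) a b \<in> borel_measurable lborel" for k
        using borel_measurable_continuous_onI[OF C_k_continuous[OF C_k_box_bump]] by simp
      hence "box_bump (real k) a b \<in> borel_measurable lebesgue" for k
        by (rule measurable_completion)
      thus "(\<lambda>x. (indicator (cbox a b) x *\<^sub>R w x) * box_bump (real k) a b x) \<in> borel_measurable lebesgue" for k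
        by (intro borel_measurable_times m)
      show "AE x in lebesgue. (\<lambda>k. (indicator (cbox a b) x *\<^sub>R w x) * box_bump (real k) a b x)
          \<longlonglongrightarrow> (indicator (cbox a b) x *\<^sub>R w x) * indicator (box a b) x"
        by (intro AE_I2 tendsto_intros box_bump_tendsto_indicator)
      show "AE x in lebesgue. norm ((indicator (cbox a b) x *\<^sub>R w x) * box_bump (real k) a b x)
          \<le> \<bar>indicator (cbox a b) x *\<^sub>R w x\<bar>" for k
        by (intro AE_I2) (simp add: abs_mult mult_left_le box_bump_range)
    qed
    moreover have "(\<lambda>x. (indicator (cbox a b) x *\<^sub>R w x) * box_bump (real m) a b x) =
        (\<lambda>x. w x * box_bump (real m) a b x)" for m
      using box_bump_0[of "real m" _ a b] box_subset_cbox[of a b] by (fastforce simp: indicator_def)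
    moreover have "(\<lambda>x. (indicator (cbox a b) x *\<^sub>R w x) * indicator (box a b) x) =
        (\<lambda>x. indicator (box a b) x * w x)"
      using box_subset_cbox[of a b] by (auto simp: indicator_def fun_eq_iff)
    moreover have "(LINT x|lebesgue. w x * box_bump (real m) a b x) = 0" for m
      by (intro 0 test_function_box_bump) simp
    ultimately show ?thesis by (simp only: LIMSEQ_const_iff)
  qed
  have "AE x in lebesgue. x \<in> box (- (\<chi> i. real R)) (\<chi> i. real R) \<longrightarrow> w x = 0" for R :: nat
  proof -
    \<comment> \<open>Global integrability is obtained by cutting \<open>w\<close> down to a large
      cube; countably many cubes exhaust the space.\<close>
    define B where "B = box (- (\<chi> i. real R)) (\<chi> i. real R :: real ^ 'n)"
    let ?w = "\<lambda>x. indicator B x * w x"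
    have "set_integrable lebesgue (cbox (- (\<chi> i. real R)) (\<chi> i. real R)) w"
      using w by (simp add: locally_integrable_def)
    hence "set_integrable lebesgue B w"
      by (rule set_integrable_subset) (auto simp: B_def box_subset_cbox)
    hence int: "integrable lebesgue ?w" by (simp add: set_integrable_def)
    \<comment> \<open>The Dynkin argument takes place on the Borel sets, so the Lebesgue measurable
      function is replaced by a Borel representative.\<close>
    obtain w' where w'[measurable]: "w' \<in> borel_measurable lborel" and eq: "AE x in lborel. ?w x = w' x"
      using completion_ex_borel_measurable_real[OF borel_measurable_integrable[OF int]] by blast
    have eq': "AE x in lebesgue. ?w x = w' x" using eq by (rule AE_completion)
    have mw': "w' \<in> borel_measurable lebesgue" using w' by (rule measurable_completion)
    have mw: "?w \<in> borel_measurable lebesgue" using int by (rule borel_measurable_integrable)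
    have int': "integrable lborel w'"
      using int integrable_cong_AE[OF mw mw' eq'] integrable_completion[OF w'] by simp
    have tot: "(LINT x|lborel. w' x) = 0"
      using integral_cong_AE[OF mw mw' eq'] box0 integral_completion[OF w'] by (simp add: B_def)
    have "(LINT x:box a b|lborel. w' x) = 0" for a b
    proof -
      have s: "box a b \<in> sets lebesgue" by simp
      have "(LINT x:box a b|lborel. w' x) = (LINT x|lebesgue. indicator (box a b) x *\<^sub>R w' x)"
        unfolding set_lebesgue_integral_def by (rule integral_completion[symmetric]) measurable
      also have "\<dots> = (LINT x|lebesgue. indicator (box a b) x *\<^sub>R ?w x)"
      proof (rule integral_cong_AE)
        show "AE x in lebesgue. indicat_real (box a b) x *\<^sub>R w' x = indicat_real (box a b) x *\<^sub>R ?w x"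
          using eq' by eventually_elim simp
      qed (intro borel_measurable_scaleR borel_measurable_indicator s mw mw')+
      also have "(\<lambda>x. indicator (box a b) x *\<^sub>R ?w x) = (\<lambda>x. indicator (box a b \<inter> B) x * w x)"
        by (auto simp: indicator_def)
      finally show ?thesis using box0 by (simp add: B_def box_Int_box)
    qed
    from AE_0_if_box_integrals_0[OF int' this tot] have "AE x in lebesgue. w' x = 0"
      by (rule AE_completion)
    with eq' show ?thesis by eventually_elim (auto simp: B_def[symmetric])
  qed
  hence "AE x in lebesgue. \<forall>R::nat. x \<in> box (- (\<chi> i. real R)) (\<chi> i. real R) \<longrightarrow> w x = 0"
    unfolding AE_all_countable by blast
  thus ?thesis
  proof eventually_elim
    case (elim x)
    obtain R :: nat where "real R > norm x" using reals_Archimedean2 by blast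
    hence "\<bar>x $ i\<bar> < real R" for i using component_le_norm_cart[of x i] by linarith
    hence "x \<in> box (- (\<chi> i. real R)) (\<chi> i. real R)"
      by (auto simp: mem_box_cart abs_less_iff) (metis minus_less_iff)
    thus ?case using elim by blast
  qed
qed

lemma integrable_locally_test:
  fixes v :: "real ^ 'n::finite \<Rightarrow> real"
  assumes v: "locally_integrable v" and \<phi>: "test_function \<phi>"
  shows "integrable lebesgue (\<lambda>x. v x * \<phi> x)"
proof -
  obtain K where K: "compact K" "\<And>x. x \<notin> K \<Longrightarrow> \<phi> x = 0" using test_function_compact_support[OF \<phi>] by blast
  have C: "C_k 0 \<phi>" using \<phi> by (simp add: test_function_def)
  obtain A where "derivs_bounded 0 1 A \<phi>"
    using derivs_bounded_compact_support[OF K(1) C K(2)] by blast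
  hence A: "\<bar>\<phi> x\<bar> \<le> A" for x by simp
  have int: "integrable lebesgue (\<lambda>x. indicator K x *\<^sub>R v x)"
    using v K(1) by (simp add: locally_integrable_def set_integrable_def)
  have "\<phi> \<in> borel_measurable lborel" using C by (simp add: borel_measurable_continuous_onI)
  hence m: "\<phi> \<in> borel_measurable lebesgue" by (rule measurable_completion)
  have "integrable lebesgue (\<lambda>x. (indicator K x *\<^sub>R v x) * \<phi> x)"
  proof (rule Bochner_Integration.integrable_bound)
    show "integrable lebesgue (\<lambda>x. A * (indicator K x *\<^sub>R v x))"
      using int by (rule integrable_mult_right)
    show "(\<lambda>x. (indicator K x *\<^sub>R v x) * \<phi> x) \<in> borel_measurable lebesgue"
      by (intro borel_measurable_times borel_measurable_integrable[OF int] m)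
    have "\<bar>indicator K x * v x\<bar> * \<bar>\<phi> x\<bar> \<le> \<bar>indicator K x * v x\<bar> * \<bar>A\<bar>" for x
      using A[of x] by (intro mult_left_mono) auto
    thus "AE x in lebesgue. norm ((indicator K x *\<^sub>R v x) * \<phi> x) \<le> norm (A * (indicator K x *\<^sub>R v x))"
      by (simp add: abs_mult mult_ac)
  qed
  moreover have "(\<lambda>x. (indicator K x *\<^sub>R v x) * \<phi> x) = (\<lambda>x. v x * \<phi> x)"
    using K(2) by (auto simp: indicator_def fun_eq_iff)
  ultimately show ?thesis by simp
qed

lemma has_weak_deriv_unique:
  assumes "has_weak_deriv \<nu> u v" "has_weak_deriv \<nu> u v'"
  shows "AE x in lebesgue. v x = v' x"
proof -
  have l: "locally_integrable v" "locally_integrable v'" using assms by (auto simp: has_weak_deriv_def)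
  have "AE x in lebesgue. v x - v' x = 0"
  proof (rule test_function_AE_0)
    show "locally_integrable (\<lambda>x. v x - v' x)"
      using l by (auto simp: locally_integrable_def)
    fix \<phi> :: "real ^ 'a \<Rightarrow> real" assume \<phi>: "test_function \<phi>"
    have "(-1) ^ mi_order \<nu> * (LINT x|lebesgue. v x * \<phi> x) =
        (-1::real) ^ mi_order \<nu> * (LINT x|lebesgue. v' x * \<phi> x)"
      using assms \<phi> unfolding has_weak_deriv_def by metis
    thus "(LINT x|lebesgue. (v x - v' x) * \<phi> x) = 0"
      using integrable_locally_test[OF l(1) \<phi>] integrable_locally_test[OF l(2) \<phi>]
      by (simp add: left_diff_distrib)
  qed
  thus ?thesis by simp
qed

text \<open>Uniqueness ties the function picked by \<open>SOME\<close> to the classical derivative;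
  all later norms are computed through this identity.\<close>

lemma weak_deriv_classical:
  fixes f :: "real ^ 'n::finite \<Rightarrow> real"
  assumes "C_k (mi_order \<nu>) f"
  shows "has_weak_deriv \<nu> f (weak_deriv \<nu> f)"
    and "AE x in lebesgue. weak_deriv \<nu> f x = foldr pderiv_dir (rev (mi_list \<nu>)) f x"
proof -
  note * = has_weak_deriv_classical[OF assms]
  show "has_weak_deriv \<nu> f (weak_deriv \<nu> f)" unfolding weak_deriv_def using * by (rule someI[of "has_weak_deriv \<nu> f"])
  from has_weak_deriv_unique[OF this *]
  show "AE x in lebesgue. weak_deriv \<nu> f x = foldr pderiv_dir (rev (mi_list \<nu>)) f x" .
qed

subsection \<open>Upper bound for the Slobodeckij integral\<close>

lemma emeasure_cbox_cart:
  fixes a b :: "real ^ 'n::finite"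
  assumes "\<And>i. a $ i \<le> b $ i"
  shows "emeasure lborel (cbox a b) = ennreal (\<Prod>i\<in>UNIV. b $ i - a $ i)"
proof -
  have "cbox a b \<noteq> {}" using assms by (auto simp: interval_ne_empty_cart)
  hence "measure lborel (cbox a b) = (\<Prod>i\<in>UNIV. b $ i - a $ i)"
    by (rule content_cbox_cart)
  thus ?thesis
    using emeasure_lborel_cbox_finite[of a b] emeasure_eq_ennreal_measure[of lborel "cbox a b"] by auto
qed

lemma nn_integral_le_cover:
  assumes [measurable]: "f \<in> borel_measurable M" "\<And>m::nat. A m \<in> sets M"
    and cover: "\<And>x. f x \<noteq> 0 \<Longrightarrow> \<exists>m. x \<in> A m"
    and bound: "\<And>m. (\<integral>\<^sup>+x. f x * indicator (A m) x \<partial>M) \<le> c m"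
  shows "(\<integral>\<^sup>+x. f x \<partial>M) \<le> (\<Sum>m. c m)"
proof -
  have "f x \<le> (\<Sum>m. f x * indicator (A m) x)" for x
  proof (cases "f x = 0")
    case False
    then obtain m where "x \<in> A m" using cover by blast
    hence "f x = f x * indicator (A m) x" by simp
    also have "\<dots> = (\<Sum>j\<in>{m}. f x * indicator (A j) x)"
      by (simp only: sum.insert[OF finite.emptyI] empty_iff not_False_eq_True sum.empty add_0_right)
    also have "\<dots> \<le> (\<Sum>m. f x * indicator (A m) x)" by (rule sum_le_suminf) auto
    finally show ?thesis .
  qed simp
  hence "(\<integral>\<^sup>+x. f x \<partial>M) \<le> (\<integral>\<^sup>+x. (\<Sum>m. f x * indicator (A m) x) \<partial>M)"
    by (intro nn_integral_mono)
  also have "\<dots> = (\<Sum>m. \<integral>\<^sup>+x. f x * indicator (A m) x \<partial>M)"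
    by (rule nn_integral_suminf) measurable
  also have "\<dots> \<le> (\<Sum>m. c m)" by (intro suminf_le bound) auto
  finally show ?thesis .
qed

text \<open>Scale invariance of |h|^(-n): the shell lies in a cube of side \<open>2 * b * r\<close>,
  while the kernel is at most \<open>c / r ^ n\<close> on it, so \<open>r\<close> cancels.\<close>

lemma nn_integral_shell_le:
  fixes \<kappa> :: "real ^ 'n::finite \<Rightarrow> real"
  assumes r: "r > 0" "b > 0" "c \<ge> 0"
    and bound: "\<And>h. r \<le> norm h \<Longrightarrow> norm h < b * r \<Longrightarrow> \<kappa> h * norm h ^ CARD('n) \<le> c"
  shows "(\<integral>\<^sup>+h. ennreal (\<kappa> h) * indicator {h. r \<le> norm h \<and> norm h < b * r} h \<partial>lborel)
           \<le> ennreal (c * (2 * b) ^ CARD('n))"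
proof -
  let ?n = "CARD('n)"
  define B where "B = cbox (\<chi> i. - (b * r)) (\<chi> i. b * r :: real ^ 'n)"
  have "ennreal (\<kappa> h) * indicator {h. r \<le> norm h \<and> norm h < b * r} h \<le> ennreal (c / r ^ ?n) * indicator B h" for h
  proof (cases "r \<le> norm h \<and> norm h < b * r")
    case True
    have "\<bar>h $ i\<bar> \<le> b * r" for i using component_le_norm_cart[of h i] True by linarith
    hence "h \<in> B" by (auto simp: B_def mem_box_cart abs_le_iff) (metis minus_le_iff)
    have pos: "norm h > 0" using True r by linarith
    hence "\<kappa> h \<le> c / norm h ^ ?n"
      using bound[of h] True by (subst pos_le_divide_eq) auto
    also have "\<dots> \<le> c / r ^ ?n" using True r pos by (intro divide_left_mono power_mono) auto
    finally show ?thesis using True \<open>h \<in> B\<close> by (simp add: ennreal_leI)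
  qed simp
  hence "(\<integral>\<^sup>+h. ennreal (\<kappa> h) * indicator {h. r \<le> norm h \<and> norm h < b * r} h \<partial>lborel)
      \<le> (\<integral>\<^sup>+h. ennreal (c / r ^ ?n) * indicator B h \<partial>lborel)" by (intro nn_integral_mono)
  also have "\<dots> = ennreal (c / r ^ ?n) * emeasure lborel B"
    by (rule nn_integral_cmult_indicator) (simp add: B_def)
  also have "emeasure lborel B = ennreal ((2 * b * r) ^ ?n)"
    unfolding B_def using r by (subst emeasure_cbox_cart)
       (auto simp: power_mult_distrib intro: order_trans[of _ 0])
  also have "ennreal (c / r ^ ?n) * \<dots> = ennreal (c / r ^ ?n * (2 * b * r) ^ ?n)"
    using r by (intro ennreal_mult[symmetric]) auto
  also have "c / r ^ ?n * (2 * b * r) ^ ?n = c * (2 * b) ^ ?n"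
    using r by (simp add: power_mult_distrib)
  finally show ?thesis .
qed

text \<open>The geometric shells, separately inside and outside the unit ball. The upper radius is
  written as \<open>b\<close> times the lower one to match \<open>nn_integral_shell_le\<close>;
  inside, \<open>Suc m\<close> makes the outermost shell end at radius 1.\<close>

lemma geometric_interval:
  assumes b: "b > 1" and t: "0 < (t::real)"
  shows "t < 1 \<Longrightarrow> \<exists>m. inverse b ^ Suc m \<le> t \<and> t < b * inverse b ^ Suc m"
    and "t \<ge> 1 \<Longrightarrow> \<exists>m. b ^ m \<le> t \<and> t < b * b ^ m"
proof -
  assume "t < 1"
  have "\<exists>m. inverse b ^ m < t" using b t by (intro real_arch_pow_inv) (auto simp: inverse_less_1_iff)
  hence ex: "\<exists>m. inverse b ^ m \<le> t" using less_imp_le by blast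
  define m where "m = (LEAST m. inverse b ^ m \<le> t)"
  have m: "inverse b ^ m \<le> t" unfolding m_def by (rule LeastI_ex[OF ex])
  hence "m \<noteq> 0" using \<open>t < 1\<close> by (intro notI) simp
  then obtain j where j: "m = Suc j" by (cases m) auto
  have "\<not> inverse b ^ j \<le> t" using not_less_Least[of j "\<lambda>m. inverse b ^ m \<le> t"] j m_def by simp
  with m j b show "\<exists>m. inverse b ^ Suc m \<le> t \<and> t < b * inverse b ^ Suc m"
    by (intro exI[of _ j]) (auto simp flip: mult.assoc)
next
  assume "t \<ge> 1"
  have ex: "\<exists>m. t < b ^ m" using b by (rule real_arch_pow)
  define m where "m = (LEAST m. t < b ^ m)"
  have m: "t < b ^ m" unfolding m_def by (rule LeastI_ex[OF ex])
  hence "m \<noteq> 0" using \<open>t \<ge> 1\<close> by (intro notI) simp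
  then obtain j where j: "m = Suc j" by (cases m) auto
  have "\<not> t < b ^ j" using not_less_Least[of j "\<lambda>m. t < b ^ m"] j m_def by simp
  with m j b show "\<exists>m. b ^ m \<le> t \<and> t < b * b ^ m"
    by (intro exI[of _ j]) auto
qed

text \<open>
  Modulus of continuity of a lacunary sum of \<open>N\<close> terms: Hoelder at all scales, and Lipschitz below
  the finest scale \<open>b^(-N)\<close>, which makes the kernel integrable at the origin.
\<close>
definition modulus :: "real \<Rightarrow> real \<Rightarrow> nat \<Rightarrow> real \<Rightarrow> real" where
  "modulus b \<theta> N t = min (min (t powr \<theta>) (b powr (real N * (1 - \<theta>)) * t)) 2"

text \<open>Majorant of the Slobodeckij integrand as a function of the increment
  \<open>h = x - y\<close> alone, with the increment of the function replaced by its
  modulus.\<close>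

definition slob_kernel :: "real \<Rightarrow> real \<Rightarrow> real \<Rightarrow> nat \<Rightarrow> real ^ 'n::finite \<Rightarrow> real" where
  "slob_kernel b \<theta> q N h = modulus b \<theta> N (norm h) powr q / norm h powr (real CARD('n) + \<theta> * q)"

lemma modulus_nonneg: "t \<ge> 0 \<Longrightarrow> modulus b \<theta> N t \<ge> 0"
  by (simp add: modulus_def)

lemma slob_kernel_mult_norm:
  fixes h :: "real ^ 'n::finite"
  assumes "h \<noteq> 0"
  shows "slob_kernel b \<theta> q N h * norm h ^ CARD('n) = (modulus b \<theta> N (norm h) / norm h powr \<theta>) powr q"
proof -
  have "norm h powr (real CARD('n) + \<theta> * q) = norm h ^ CARD('n) * (norm h powr \<theta>) powr q"
    using assms by (simp add: powr_add powr_realpow powr_powr)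
  thus ?thesis using assms by (simp add: slob_kernel_def powr_divide modulus_nonneg)
qed

lemma slob_kernel_measurable [measurable]: "slob_kernel b \<theta> q N \<in> borel_measurable borel"
  unfolding slob_kernel_def[abs_def] modulus_def[abs_def] by measurable

text \<open>On the first \<open>N\<close> shells the Hoelder branch of \<open>modulus\<close> makes
  the ratio to |h|^\<theta> at most 1. Below the finest scale the Lipschitz branch takes over and
  leaves a power of |h| with exponent \<open>1 - \<theta>\<close>, hence geometric decay in
  \<open>m - N\<close>.\<close>

lemma slob_kernel_inner:
  fixes h :: "real ^ 'n::finite"
  assumes b: "b > 1" and \<theta>: "0 < \<theta>" "\<theta> < 1" and q: "q > 0"
    and h: "inverse b ^ Suc m \<le> norm h" "norm h < b * inverse b ^ Suc m"
  shows "slob_kernel b \<theta> q N h * norm h ^ CARD('n) \<le>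
           (if m < N then 1 else (b powr (- (1 - \<theta>) * q)) ^ (m - N))"
proof -
  let ?t = "norm h"
  have "inverse b ^ Suc m > 0" using b by simp
  hence t: "?t > 0" using h(1) by linarith
  hence "h \<noteq> 0" by auto
  have "modulus b \<theta> N ?t / ?t powr \<theta> \<le> 1"
    using t by (simp add: modulus_def)
  hence 1: "(modulus b \<theta> N ?t / ?t powr \<theta>) powr q \<le> 1"
    using q by (intro powr_le1) (auto simp: modulus_nonneg)
  have 2: "(modulus b \<theta> N ?t / ?t powr \<theta>) powr q \<le> (b powr (- (1 - \<theta>) * q)) ^ (m - N)" if "N \<le> m"
  proof -
    have "?t < b powr (- real m)"
      
      using h(2) b by (simp add: powr_minus powr_realpow power_inverse flip: mult.assoc)
    hence t': "?t powr (1 - \<theta>) \<le> (b powr (- real m)) powr (1 - \<theta>)"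
      using t \<theta> by (intro powr_mono2) auto
    have "modulus b \<theta> N ?t / ?t powr \<theta> \<le> b powr (real N * (1 - \<theta>)) * ?t / ?t powr \<theta>"
      by (intro divide_right_mono) (auto simp: modulus_def)
    also have "\<dots> = b powr (real N * (1 - \<theta>)) * ?t powr (1 - \<theta>)"
      using t by (simp add: powr_diff)
    also have "\<dots> \<le> b powr (real N * (1 - \<theta>)) * (b powr (- real m)) powr (1 - \<theta>)"
      using t' by (intro mult_left_mono) auto
    also have "\<dots> = b powr (- (1 - \<theta>) * real (m - N))"
      using that by (simp add: powr_powr powr_add[symmetric] of_nat_diff algebra_simps)
    finally have "(modulus b \<theta> N ?t / ?t powr \<theta>) powr q \<le> (b powr (- (1 - \<theta>) * real (m - N))) powr q"
      using q by (intro powr_mono2) (auto simp: modulus_nonneg)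
    also have "\<dots> = (b powr (- (1 - \<theta>) * q)) ^ (m - N)"
      using b by (simp add: powr_powr powr_realpow[symmetric] mult_ac)
    finally show ?thesis .
  qed
  show ?thesis using 1 2 \<open>h \<noteq> 0\<close> by (simp add: slob_kernel_mult_norm)
qed

text \<open>At large distances only the constant branch 2 of \<open>modulus\<close> is useful; the
  weight then decays geometrically.\<close>

lemma slob_kernel_outer:
  fixes h :: "real ^ 'n::finite"
  assumes b: "b > 1" and \<theta>: "0 < \<theta>" and q: "q > 0" and h: "b ^ m \<le> norm h"
  shows "slob_kernel b \<theta> q N h * norm h ^ CARD('n) \<le> 2 powr q * (b powr (- \<theta> * q)) ^ m"
proof -
  let ?t = "norm h"
  have "b ^ m > 0" using b by simp
  hence t: "?t > 0" using h by linarith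
  hence "h \<noteq> 0" by auto
  have "modulus b \<theta> N ?t / ?t powr \<theta> \<le> 2 / (b ^ m) powr \<theta>"
    using t b h \<theta> by (intro frac_le powr_mono2) (auto simp: modulus_def)
  hence "(modulus b \<theta> N ?t / ?t powr \<theta>) powr q \<le> (2 / (b ^ m) powr \<theta>) powr q"
    using q by (intro powr_mono2) (auto simp: modulus_nonneg)
  also have "\<dots> = 2 powr q * (b powr (- \<theta> * q)) ^ m"
    using b by (simp add: powr_divide powr_powr powr_realpow[symmetric] powr_minus divide_simps mult_ac)
  finally show ?thesis using \<open>h \<noteq> 0\<close> by (simp add: slob_kernel_mult_norm)
qed

text \<open>Growth is linear in \<open>N\<close> for every exponent \<open>q\<close>:
  \<open>N\<close> shells count with weight 1, and the two geometric tails are independent of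
  \<open>N\<close>. Taking the root of order \<open>q\<close> later is what separates the
  exponents.\<close>

lemma nn_integral_slob_kernel:
  assumes b: "b > 1" and \<theta>: "0 < \<theta>" "\<theta> < 1" and q: "q > 0"
  shows "\<exists>C\<ge>0. \<forall>N. (\<integral>\<^sup>+h. ennreal (slob_kernel b \<theta> q N (h :: real ^ 'n::finite)) \<partial>lborel)
           \<le> ennreal (C * (real N + 1))"
proof -
  let ?n = "CARD('n)"
  define \<rho> \<sigma> where "\<rho> = b powr (- (1 - \<theta>) * q)" and "\<sigma> = b powr (- \<theta> * q)"
  have \<rho>: "0 \<le> \<rho>" "\<rho> < 1" and \<sigma>: "0 \<le> \<sigma>" "\<sigma> < 1"
    using b \<theta> q powr_less_mono[of "- (1 - \<theta>) * q" 0 b] powr_less_mono[of "- \<theta> * q" 0 b]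
    by (auto simp: \<rho>_def \<sigma>_def mult_neg_pos)
  \<comment> \<open>The common volume factor of the shells, times the weights of one middle shell,
    of the tail below the finest scale, and of the tail outside the unit ball.\<close>
  define C where "C = (2 * b) ^ ?n * (1 + 1 / (1 - \<rho>) + 2 powr q / (1 - \<sigma>))"
  have C: "C \<ge> 0" using b \<rho> \<sigma> by (auto simp: C_def intro!: mult_nonneg_nonneg add_nonneg_nonneg)
  have "(\<integral>\<^sup>+h. ennreal (slob_kernel b \<theta> q N (h :: real ^ 'n)) \<partial>lborel) \<le> ennreal (C * (real N + 1))" for N
  proof -
    let ?\<kappa> = "slob_kernel b \<theta> q N :: real ^ 'n \<Rightarrow> real"
    have \<kappa>: "(\<lambda>h. ennreal (?\<kappa> h)) \<in> borel_measurable lborel"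
      using measurable_compose[OF slob_kernel_measurable measurable_ennreal] by simp
    have *: "(\<lambda>h. ennreal (?\<kappa> h) * indicator A h) \<in> borel_measurable lborel" if "A \<in> sets borel" for A
      using that by (intro borel_measurable_times_ennreal \<kappa> borel_measurable_indicator) simp
    have \<kappa>1: "(\<lambda>h. ennreal (?\<kappa> h) * indicator (ball 0 1) h) \<in> borel_measurable lborel"
      and \<kappa>2: "(\<lambda>h. ennreal (?\<kappa> h) * indicator (- ball 0 1) h) \<in> borel_measurable lborel"
      using *[of "ball 0 1"] *[of "- ball 0 1"] by simp_all
    have shell: "{h :: real ^ 'n. r \<le> norm h \<and> norm h < t} \<in> sets lborel" for r t
      by simp
    define c where "c m = (if m < N then 1 else \<rho> ^ (m - N))" for m
    have c: "c m \<ge> 0" for m using \<rho> by (simp add: c_def)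
    have "(\<lambda>m. c (m + N)) sums (1 / (1 - \<rho>))"
      using geometric_sums[of \<rho>] \<rho> by (simp add: c_def)
    hence sc: "c sums (real N + 1 / (1 - \<rho>))"
      by (subst (asm) sums_iff_shift) (simp add: c_def add_ac)
    have so: "(\<lambda>m. 2 powr q * \<sigma> ^ m) sums (2 powr q / (1 - \<sigma>))"
      using sums_mult[OF geometric_sums[of \<sigma>], of "2 powr q"] \<sigma> by simp
    have "(\<integral>\<^sup>+h. ennreal (?\<kappa> h) * indicator (ball 0 1) h \<partial>lborel) \<le> (\<Sum>m. ennreal (c m * (2 * b) ^ ?n))"
    proof (rule nn_integral_le_cover[where A = "\<lambda>m. {h. inverse b ^ Suc m \<le> norm h \<and> norm h < b * inverse b ^ Suc m}"])
      fix h :: "real ^ 'n" assume "ennreal (?\<kappa> h) * indicator (ball 0 1) h \<noteq> 0"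
      hence "norm h < 1" "norm h > 0" by (auto simp: slob_kernel_def indicator_def split: if_splits)
      thus "\<exists>m. h \<in> {h. inverse b ^ Suc m \<le> norm h \<and> norm h < b * inverse b ^ Suc m}"
        using geometric_interval(1)[OF b] by blast
    next
      fix m
      have "(\<integral>\<^sup>+h. ennreal (?\<kappa> h) * indicator (ball 0 1) h *
            indicator {h. inverse b ^ Suc m \<le> norm h \<and> norm h < b * inverse b ^ Suc m} h \<partial>lborel) \<le>
          (\<integral>\<^sup>+h. ennreal (?\<kappa> h) *
            indicator {h. inverse b ^ Suc m \<le> norm h \<and> norm h < b * inverse b ^ Suc m} h \<partial>lborel)"
        by (intro nn_integral_mono) (auto simp: indicator_def)
      also have "\<dots> \<le> ennreal (c m * (2 * b) ^ ?n)"
        using slob_kernel_inner[OF b \<theta> q, of m _ N] b c[of m]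
        by (intro nn_integral_shell_le) (auto simp: c_def \<rho>_def)
      finally show "(\<integral>\<^sup>+h. ennreal (?\<kappa> h) * indicator (ball 0 1) h *
            indicator {h. inverse b ^ Suc m \<le> norm h \<and> norm h < b * inverse b ^ Suc m} h \<partial>lborel) \<le>
          ennreal (c m * (2 * b) ^ ?n)" .
    qed (rule \<kappa>1 shell)+
    also have "(\<Sum>m. ennreal (c m * (2 * b) ^ ?n)) = ennreal ((real N + 1 / (1 - \<rho>)) * (2 * b) ^ ?n)"
      using b c by (intro suminf_ennreal_eq sums_mult2 sc) auto
    finally have 1: "(\<integral>\<^sup>+h. ennreal (?\<kappa> h) * indicator (ball 0 1) h \<partial>lborel)
        \<le> ennreal ((real N + 1 / (1 - \<rho>)) * (2 * b) ^ ?n)" .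
    have "(\<integral>\<^sup>+h. ennreal (?\<kappa> h) * indicator (- ball 0 1) h \<partial>lborel) \<le>
        (\<Sum>m. ennreal (2 powr q * \<sigma> ^ m * (2 * b) ^ ?n))"
    proof (rule nn_integral_le_cover[where A = "\<lambda>m. {h. b ^ m \<le> norm h \<and> norm h < b * b ^ m}"])
      fix h :: "real ^ 'n" assume "ennreal (?\<kappa> h) * indicator (- ball 0 1) h \<noteq> 0"
      hence "norm h \<ge> 1" "norm h > 0" by (auto simp: slob_kernel_def indicator_def split: if_splits)
      thus "\<exists>m. h \<in> {h. b ^ m \<le> norm h \<and> norm h < b * b ^ m}"
        using geometric_interval(2)[OF b] by blast
    next
      fix m
      have "(\<integral>\<^sup>+h. ennreal (?\<kappa> h) * indicator (- ball 0 1) h *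
            indicator {h. b ^ m \<le> norm h \<and> norm h < b * b ^ m} h \<partial>lborel) \<le>
          (\<integral>\<^sup>+h. ennreal (?\<kappa> h) * indicator {h. b ^ m \<le> norm h \<and> norm h < b * b ^ m} h \<partial>lborel)"
        by (intro nn_integral_mono) (auto simp: indicator_def)
      also have "\<dots> \<le> ennreal (2 powr q * \<sigma> ^ m * (2 * b) ^ ?n)"
        using slob_kernel_outer[OF b \<theta>(1) q, of m _ N] b \<sigma>
        by (intro nn_integral_shell_le) (auto simp: \<sigma>_def)
      finally show "(\<integral>\<^sup>+h. ennreal (?\<kappa> h) * indicator (- ball 0 1) h *
            indicator {h. b ^ m \<le> norm h \<and> norm h < b * b ^ m} h \<partial>lborel) \<le>
          ennreal (2 powr q * \<sigma> ^ m * (2 * b) ^ ?n)" .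
    qed (rule \<kappa>2 shell)+
    also have "(\<Sum>m. ennreal (2 powr q * \<sigma> ^ m * (2 * b) ^ ?n)) = ennreal (2 powr q / (1 - \<sigma>) * (2 * b) ^ ?n)"
      using b \<sigma> by (intro suminf_ennreal_eq sums_mult2 so) auto
    finally have 2: "(\<integral>\<^sup>+h. ennreal (?\<kappa> h) * indicator (- ball 0 1) h \<partial>lborel)
        \<le> ennreal (2 powr q / (1 - \<sigma>) * (2 * b) ^ ?n)" .
    have "(\<integral>\<^sup>+h. ennreal (?\<kappa> h) \<partial>lborel) =
        (\<integral>\<^sup>+h. ennreal (?\<kappa> h) * indicator (ball 0 1) h + ennreal (?\<kappa> h) * indicator (- ball 0 1) h \<partial>lborel)"
      by (intro nn_integral_cong) (auto simp: indicator_def)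
    also have "\<dots> = (\<integral>\<^sup>+h. ennreal (?\<kappa> h) * indicator (ball 0 1) h \<partial>lborel) +
        (\<integral>\<^sup>+h. ennreal (?\<kappa> h) * indicator (- ball 0 1) h \<partial>lborel)"
      by (rule nn_integral_add[OF \<kappa>1 \<kappa>2])
    also have "\<dots> \<le> ennreal ((real N + 1 / (1 - \<rho>)) * (2 * b) ^ ?n) +
        ennreal (2 powr q / (1 - \<sigma>) * (2 * b) ^ ?n)"
      by (rule add_mono[OF 1 2])
    also have "\<dots> = ennreal ((real N + 1 / (1 - \<rho>)) * (2 * b) ^ ?n + 2 powr q / (1 - \<sigma>) * (2 * b) ^ ?n)"
      using b \<rho> \<sigma> by (intro ennreal_plus[symmetric]) auto
    also have "\<dots> \<le> ennreal (C * (real N + 1))"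
    proof (rule ennreal_leI)
      have "(real N + 1 / (1 - \<rho>)) * (2 * b) ^ ?n + 2 powr q / (1 - \<sigma>) * (2 * b) ^ ?n =
          (2 * b) ^ ?n * (real N * 1 + (1 / (1 - \<rho>) + 2 powr q / (1 - \<sigma>)))"
        by (simp add: algebra_simps)
      also have "\<dots> \<le> (2 * b) ^ ?n * ((1 + 1 / (1 - \<rho>) + 2 powr q / (1 - \<sigma>)) * (real N + 1))"
      proof (intro mult_left_mono)
        have "real N * 1 + y \<le> (1 + y) * (real N + 1)" if "y \<ge> 0" for y
          using that by (simp add: algebra_simps)
        from this[of "1 / (1 - \<rho>) + 2 powr q / (1 - \<sigma>)"]
        show "real N * 1 + (1 / (1 - \<rho>) + 2 powr q / (1 - \<sigma>)) \<le>
            (1 + 1 / (1 - \<rho>) + 2 powr q / (1 - \<sigma>)) * (real N + 1)"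
          using \<rho> \<sigma> by (simp only: add.assoc) (simp add: add_nonneg_nonneg)
      qed (use b in simp)
      finally show "(real N + 1 / (1 - \<rho>)) * (2 * b) ^ ?n + 2 powr q / (1 - \<sigma>) * (2 * b) ^ ?n \<le> C * (real N + 1)"
        by (simp add: C_def mult_ac)
    qed
    finally show ?thesis .
  qed
  with C show ?thesis by blast
qed

section \<open>From the kernel in \<open>h\<close> to the double integral\<close>

lemma nn_integral_translation:
  fixes f :: "real ^ 'n::finite \<Rightarrow> ennreal"
  assumes "f \<in> borel_measurable borel"
  shows "(\<integral>\<^sup>+x. f (c + x) \<partial>lborel) = (\<integral>\<^sup>+x. f x \<partial>lborel)"
proof -
  have "(\<integral>\<^sup>+x. f x \<partial>lborel) = (\<integral>\<^sup>+x. f x \<partial>distr lborel borel ((+) c))"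
    by (simp add: lborel_distr_plus)
  also have "\<dots> = (\<integral>\<^sup>+x. f (c + x) \<partial>lborel)"
    using assms by (intro nn_integral_distr) auto
  finally show ?thesis ..
qed

lemma nn_integral_lborel_pair:
  fixes f :: "(real ^ 'n::finite) \<times> (real ^ 'n) \<Rightarrow> ennreal"
  assumes [measurable]: "f \<in> borel_measurable borel"
  shows "(\<integral>\<^sup>+z. f z \<partial>lborel) = (\<integral>\<^sup>+x. \<integral>\<^sup>+y. f (x, y) \<partial>lborel \<partial>lborel)"
    and "(\<integral>\<^sup>+z. f z \<partial>lborel) = (\<integral>\<^sup>+y. \<integral>\<^sup>+x. f (x, y) \<partial>lborel \<partial>lborel)"
proof -
  have "f \<in> borel_measurable (lborel \<Otimes>\<^sub>M lborel)"
    unfolding lborel_prod using assms by simp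
  from lborel.nn_integral_fst[OF this] lborel_pair.nn_integral_snd[OF this]
  show "(\<integral>\<^sup>+z. f z \<partial>lborel) = (\<integral>\<^sup>+x. \<integral>\<^sup>+y. f (x, y) \<partial>lborel \<partial>lborel)"
    and "(\<integral>\<^sup>+z. f z \<partial>lborel) = (\<integral>\<^sup>+y. \<integral>\<^sup>+x. f (x, y) \<partial>lborel \<partial>lborel)"
    by (simp_all add: lborel_prod)
qed

lemma Slobodeckij_integrand_measurable:
  fixes F :: "real ^ 'n::finite \<Rightarrow> real"
  assumes "continuous_on UNIV F"
  shows "Slobodeckij_integrand \<theta> q F \<in> borel_measurable borel"
proof -
  have [measurable]: "F \<in> borel_measurable borel"
    using assms by (rule borel_measurable_continuous_onI)
  have "(\<lambda>z :: (real ^ 'n) \<times> (real ^ 'n). \<bar>F (fst z) - F (snd z)\<bar> powr q /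
      norm (fst z - snd z) powr (real CARD('n) + \<theta> * q)) \<in> borel_measurable (borel \<Otimes>\<^sub>M borel)"
    by measurable
  thus ?thesis by (simp add: Slobodeckij_integrand_def case_prod_beta borel_prod)
qed

text \<open>The integrand vanishes unless \<open>x\<close> or \<open>y\<close> lies in
  \<open>K\<close>. Each of the two strips contributes, by Tonelli and translation invariance, the
  volume of \<open>K\<close> times the integral of the kernel; this gives the factor
  \<open>2 * V * C\<close>. The constant is chosen before \<open>N\<close>, \<open>F\<close> and
  \<open>M\<close>.\<close>

lemma Slobodeckij_upper_bound:
  assumes b: "b > 1" and \<theta>: "0 < \<theta>" "\<theta> < 1" and q: "q > 0" and K: "compact (K :: (real ^ 'n::finite) set)"
  shows "\<exists>C\<ge>0. \<forall>N F M. continuous_on UNIV F \<longrightarrow> (\<forall>x. x \<notin> K \<longrightarrow> F x = 0) \<longrightarrow> M \<ge> 0 \<longrightarrow>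
    (\<forall>x y. \<bar>F x - F y\<bar> \<le> M * modulus b \<theta> N (norm (x - y))) \<longrightarrow>
    integrable lborel (Slobodeckij_integrand \<theta> q F) \<and>
    (LINT z|lborel. Slobodeckij_integrand \<theta> q F z) \<le> C * M powr q * (real N + 1)"
proof -
  obtain C where C: "C \<ge> 0" "\<And>N. (\<integral>\<^sup>+h. ennreal (slob_kernel b \<theta> q N (h :: real ^ 'n)) \<partial>lborel)
           \<le> ennreal (C * (real N + 1))"
    using nn_integral_slob_kernel[OF b \<theta> q] by blast
  have Kfin: "emeasure lborel K < \<infinity>" using K by (rule emeasure_compact_finite)
  define V where "V = measure lborel K"
  have V: "emeasure lborel K = ennreal V" "V \<ge> 0"
    using Kfin by (auto simp: V_def emeasure_eq_ennreal_measure)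
  have Ks: "K \<in> sets borel" using K by (rule borel_compact)
  show ?thesis
  proof (intro exI[of _ "2 * V * C"] conjI allI impI)
    show "2 * V * C \<ge> 0" using V C by simp
    fix N F M assume F: "continuous_on UNIV F" "\<forall>x. x \<notin> K \<longrightarrow> F x = 0" and M: "(M::real) \<ge> 0"
      and mod: "\<forall>x y. \<bar>F x - F y\<bar> \<le> M * modulus b \<theta> N (norm (x - y))"
    let ?I = "Slobodeckij_integrand \<theta> q F" and ?\<kappa> = "slob_kernel b \<theta> q N :: real ^ 'n \<Rightarrow> real"
    have I0: "?I z \<ge> 0" for z by (cases z) (simp add: Slobodeckij_integrand_def)
    have I[measurable]: "?I \<in> borel_measurable borel"
      using F(1) by (rule Slobodeckij_integrand_measurable)
    have bd: "ennreal (?I (x, y)) \<le> ennreal (M powr q) *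
        (indicator K x * ennreal (?\<kappa> (y - x)) + indicator K y * ennreal (?\<kappa> (x - y)))" for x y
    \<comment> \<open>The kernel is even in \<open>h\<close>, so either indicator on the right may
      pay for the integrand, whichever of the two points lies in \<open>K\<close>.\<close>
    proof (cases "x \<in> K \<or> y \<in> K")
      case True
      have sym: "?\<kappa> (y - x) = ?\<kappa> (x - y)" by (simp add: slob_kernel_def norm_minus_commute)
      have "\<bar>F x - F y\<bar> powr q \<le> (M * modulus b \<theta> N (norm (x - y))) powr q"
        using mod q by (intro powr_mono2) auto
      hence "?I (x, y) \<le> M powr q * ?\<kappa> (x - y)"
        using M by (simp add: Slobodeckij_integrand_def slob_kernel_def powr_mult modulus_nonneg divide_right_mono)
      hence "ennreal (?I (x, y)) \<le> ennreal (M powr q) * ennreal (?\<kappa> (x - y))"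
        by (simp add: ennreal_mult'[symmetric] ennreal_leI)
      also have "ennreal (?\<kappa> (x - y)) \<le>
          indicator K x * ennreal (?\<kappa> (y - x)) + indicator K y * ennreal (?\<kappa> (x - y))"
        using True unfolding sym by (auto simp: indicator_def)
      finally show ?thesis by (simp add: mult_left_mono)
    next
      case False
      thus ?thesis using F(2) by (simp add: Slobodeckij_integrand_def)
    qed
    have m1: "(\<lambda>z. indicator K (fst z) * ennreal (?\<kappa> (snd z - fst z))) \<in> borel_measurable borel"
      and m2: "(\<lambda>z. indicator K (snd z) * ennreal (?\<kappa> (fst z - snd z))) \<in> borel_measurable borel"
      unfolding borel_prod[symmetric]
      by (intro borel_measurable_times_ennreal measurable_compose[OF _ borel_measurable_indicator[OF Ks]]
          measurable_compose[OF _ measurable_ennreal] measurable_compose[OF _ slob_kernel_measurable]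
          borel_measurable_diff measurable_fst measurable_snd)+
    have half: "(\<integral>\<^sup>+x. \<integral>\<^sup>+y. indicator K x * ennreal (?\<kappa> (y - x)) \<partial>lborel \<partial>lborel) =
        (\<integral>\<^sup>+h. ennreal (?\<kappa> h) \<partial>lborel) * emeasure lborel K"
    proof -
      have "(\<integral>\<^sup>+y. indicator K x * ennreal (?\<kappa> (y - x)) \<partial>lborel) =
          (\<integral>\<^sup>+h. ennreal (?\<kappa> h) \<partial>lborel) * indicator K x" for x
        using nn_integral_translation[of "\<lambda>h. ennreal (?\<kappa> h)" "- x"]
          measurable_compose[OF slob_kernel_measurable measurable_ennreal]
        by (subst nn_integral_cmult) (auto simp: mult.commute)
      thus ?thesis using Ks by (simp add: nn_integral_cmult)
    qed
    have "(\<integral>\<^sup>+z. ennreal (?I z) \<partial>lborel) \<le> (\<integral>\<^sup>+z. ennreal (M powr q) *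
        (indicator K (fst z) * ennreal (?\<kappa> (snd z - fst z)) +
         indicator K (snd z) * ennreal (?\<kappa> (fst z - snd z))) \<partial>lborel)"
      using bd by (intro nn_integral_mono) (auto simp: split_paired_all)
    also have "\<dots> = ennreal (M powr q) * ((\<integral>\<^sup>+z. indicator K (fst z) * ennreal (?\<kappa> (snd z - fst z)) \<partial>lborel) +
        (\<integral>\<^sup>+z. indicator K (snd z) * ennreal (?\<kappa> (fst z - snd z)) \<partial>lborel))"
      using m1 m2 by (simp add: nn_integral_cmult nn_integral_add)
    also have "(\<integral>\<^sup>+z. indicator K (fst z) * ennreal (?\<kappa> (snd z - fst z)) \<partial>lborel) =
        (\<integral>\<^sup>+h. ennreal (?\<kappa> h) \<partial>lborel) * emeasure lborel K"
      by (subst nn_integral_lborel_pair(1)[OF m1]) (simp add: half)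
    also have "(\<integral>\<^sup>+z. indicator K (snd z) * ennreal (?\<kappa> (fst z - snd z)) \<partial>lborel) =
        (\<integral>\<^sup>+h. ennreal (?\<kappa> h) \<partial>lborel) * emeasure lborel K"
      by (subst nn_integral_lborel_pair(2)[OF m2]) (simp add: half)
    also have "ennreal (M powr q) * ((\<integral>\<^sup>+h. ennreal (?\<kappa> h) \<partial>lborel) * emeasure lborel K +
        (\<integral>\<^sup>+h. ennreal (?\<kappa> h) \<partial>lborel) * emeasure lborel K) \<le>
        ennreal (M powr q) * (ennreal (C * (real N + 1)) * ennreal V + ennreal (C * (real N + 1)) * ennreal V)"
      unfolding V(1) by (intro mult_left_mono add_mono mult_right_mono C(2)) auto
    also have "\<dots> = ennreal (2 * V * C * M powr q * (real N + 1))"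
      using V C(1) by (simp add: ennreal_mult''[symmetric] ennreal_plus[symmetric] mult_ac del: ennreal_plus)
    finally have le: "(\<integral>\<^sup>+z. ennreal (?I z) \<partial>lborel) \<le> ennreal (2 * V * C * M powr q * (real N + 1))" .
    show int: "integrable lborel ?I"
      using I le I0 by (intro integrableI_bounded) (auto simp: le_less_trans[OF _ ennreal_less_top])
    have "ennreal (LINT z|lborel. ?I z) = (\<integral>\<^sup>+z. ennreal (?I z) \<partial>lborel)"
      using int I0 by (intro nn_integral_eq_integral[symmetric]) auto
    with le have "ennreal (LINT z|lborel. ?I z) \<le> ennreal (2 * V * C * M powr q * (real N + 1))" by simp
    thus "(LINT z|lborel. ?I z) \<le> 2 * V * C * M powr q * (real N + 1)"
      using V C(1) M by (subst (asm) ennreal_le_iff) auto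
  qed
qed

text \<open>If \<open>N\<close> is null in R^n, then both cylinders over \<open>N\<close> are null
  in the product.\<close>

lemma AE_lborel_pair:
  fixes P :: "real ^ 'n::finite \<Rightarrow> bool"
  assumes "AE x in lebesgue. P x"
  shows "AE z in lebesgue. P (fst z) \<and> P (snd z)"
proof -
  have "AE x in lborel. P x" using assms by (simp add: AE_completion_iff)
  then obtain N where N: "N \<in> null_sets lborel" "\<And>x. x \<notin> N \<Longrightarrow> P x"
    by (auto elim!: AE_E3)
  have "N \<times> UNIV \<in> null_sets (lborel \<Otimes>\<^sub>M lborel)" "UNIV \<times> N \<in> null_sets (lborel \<Otimes>\<^sub>M lborel)"
    using N(1) by (auto simp: null_sets_def lborel.emeasure_pair_measure_Times)
  hence "AE z in lborel. z \<notin> N \<times> (UNIV :: (real^'n) set)" "AE z in lborel. z \<notin> (UNIV :: (real^'n) set) \<times> N"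
    unfolding lborel_prod by (auto intro: AE_not_in)
  hence "AE z in lborel. P (fst z) \<and> P (snd z)"
    by eventually_elim (use N(2) in \<open>auto simp: mem_Times_iff\<close>)
  thus ?thesis by (rule AE_completion)
qed

text \<open>Passes at once from a chosen representative under the completed measure to a continuous
  function under \<open>lborel\<close>, where iterated integration is available.\<close>

lemma Slobodeckij_integrand_AE_cong:
  fixes F w :: "real ^ 'n::finite \<Rightarrow> real"
  assumes eq: "AE x in lebesgue. w x = F x" and F: "continuous_on UNIV F"
  shows "integrable lebesgue (Slobodeckij_integrand \<theta> q w) \<longleftrightarrow> integrable lborel (Slobodeckij_integrand \<theta> q F)"
    and "(LINT z|lebesgue. Slobodeckij_integrand \<theta> q w z) = (LINT z|lborel. Slobodeckij_integrand \<theta> q F z)"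
proof -
  have mF: "Slobodeckij_integrand \<theta> q F \<in> borel_measurable lborel"
    using Slobodeckij_integrand_measurable[OF F] by simp
  hence mF': "Slobodeckij_integrand \<theta> q F \<in> borel_measurable lebesgue"
    by (rule measurable_completion)
  have ae: "AE z in lebesgue. Slobodeckij_integrand \<theta> q F z = Slobodeckij_integrand \<theta> q w z"
    using AE_lborel_pair[OF eq] by eventually_elim (auto simp: Slobodeckij_integrand_def case_prod_beta)
  have mw: "Slobodeckij_integrand \<theta> q w \<in> borel_measurable lebesgue"
    using borel_measurable_AE[OF mF' ae] .
  show "integrable lebesgue (Slobodeckij_integrand \<theta> q w) \<longleftrightarrow> integrable lborel (Slobodeckij_integrand \<theta> q F)"
    using integrable_cong_AE[OF mF' mw ae] integrable_completion[OF mF] by simp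
  show "(LINT z|lebesgue. Slobodeckij_integrand \<theta> q w z) = (LINT z|lborel. Slobodeckij_integrand \<theta> q F z)"
    using integral_cong_AE[OF mF' mw ae] integral_completion[OF mF] by simp
qed

subsection \<open>Lower bound for lacunary sums\<close>

text \<open>Move the argument to within 1/2 of a point where the cosine is extremal with the sign
  opposite to \<open>cos y\<close>. Since 1/2 is less than pi/3, the cosine there has absolute value
  at least 1/2. The admissible shifts form an interval of length 1, recurring with period 2 pi, so
  one starts between 1 and 8.\<close>

lemma cos_shift_interval:
  fixes y :: real
  obtains a where "1 \<le> a" "a \<le> 8" "\<And>\<tau>. a \<le> \<tau> \<Longrightarrow> \<tau> \<le> a + 1 \<Longrightarrow> \<bar>cos (y + \<tau>) - cos y\<bar> \<ge> 1 / 2"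
proof -
  \<comment> \<open>The target of \<open>y + \<tau>\<close> modulo 2 pi: a maximum of the cosine if
    \<open>cos y\<close> is not positive, a minimum otherwise. Subtracting 1/2 in \<open>z\<close>
    centres the interval of shifts on it.\<close>
  define c0 where "c0 = (if cos y \<le> 0 then 0 else pi)"
  define z where "z = - y - 1 / 2 + c0"
  \<comment> \<open>The least number of periods that brings the left end up to 1; then it is below 1
    + 2 pi.\<close>
  define k where "k = \<lceil>(1 - z) / (2 * pi)\<rceil>"
  define a where "a = z + 2 * pi * of_int k"
  have "(1 - z) / (2 * pi) \<le> of_int k" "of_int k < (1 - z) / (2 * pi) + 1"
    unfolding k_def by linarith+
  hence "1 - z \<le> 2 * pi * of_int k" "2 * pi * of_int k < 1 - z + 2 * pi"
    by (simp_all add: field_simps)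
  hence a: "1 \<le> a" "a \<le> 8" using pi_less_4 pi_approx by (auto simp: a_def)
  have "\<bar>cos (y + \<tau>) - cos y\<bar> \<ge> 1 / 2" if "a \<le> \<tau>" "\<tau> \<le> a + 1" for \<tau>
  proof -
    define s where "s = \<tau> - a - 1 / 2"
    have s: "\<bar>s\<bar> \<le> 1 / 2" using that by (auto simp: s_def abs_if)
    have "cos (pi / 3) \<le> cos \<bar>s\<bar>"
      using s pi_gt3 by (intro cos_monotone_0_pi_le) auto
    hence cs: "cos s \<ge> 1 / 2" by (simp add: cos_60)
    have "y + \<tau> = (c0 + s) + 2 * pi * of_int k" by (simp add: s_def a_def z_def)
    hence "cos (y + \<tau>) = cos (c0 + s)"
      by (simp only: cos_add[of "c0 + s"] cos_int_2pin sin_int_2pin mult_1_right mult_zero_right diff_zero)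
    also have "\<dots> = (if cos y \<le> 0 then cos s else - cos s)" by (simp add: c0_def)
    finally show ?thesis using cs by (auto split: if_splits)
  qed
  with a show thesis using that by blast
qed

lemma abs_cos_diff_le: "\<bar>cos x - cos y\<bar> \<le> \<bar>x - y :: real\<bar>"
proof -
  have "\<bar>cos x - cos y\<bar> \<le> 1 * \<bar>x - y\<bar>"
    by (rule field_differentiable_bound[of UNIV cos "\<lambda>x. - sin x" 1 x y, unfolded real_norm_def])
       (auto intro!: derivative_eq_intros)
  thus ?thesis by simp
qed

lemma geometric_sum_le:
  fixes A :: real
  assumes "A > 1"
  shows "(\<Sum>j<m. A ^ j) \<le> A ^ m / (A - 1)"
  using assms by (simp add: geometric_sum divide_right_mono)

lemma geometric_tail_le:
  fixes \<beta> :: real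
  assumes "0 < \<beta>" "\<beta> < 1"
  shows "(\<Sum>j=m..<N. \<beta> ^ j) \<le> \<beta> ^ m / (1 - \<beta>)"
proof (cases "m \<le> N")
  case True
  hence "(\<Sum>j=m..<N. \<beta> ^ j) = (\<beta> ^ m - \<beta> ^ N) / (1 - \<beta>)"
  proof (induction N rule: dec_induct)
    case (step n)
    have "(\<Sum>j=m..<Suc n. \<beta> ^ j) = (\<beta> ^ m - \<beta> ^ n) / (1 - \<beta>) + \<beta> ^ n"
      using step by simp
    also have "\<dots> = (\<beta> ^ m - \<beta> ^ Suc n) / (1 - \<beta>)" using assms by (simp add: field_simps)
    finally show ?case .
  qed simp
  also have "\<dots> \<le> \<beta> ^ m / (1 - \<beta>)" using assms by (intro divide_right_mono) auto
  finally show ?thesis .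
qed (use assms in simp)

text \<open>A truncated Weierstrass function. The phase \<phi> records that each of the
  \<open>k\<close> derivatives shifts the cosine by pi/2.\<close>

definition lacunary :: "real \<Rightarrow> real \<Rightarrow> real \<Rightarrow> nat \<Rightarrow> real \<Rightarrow> real" where
  "lacunary b \<beta> \<phi> N t = (\<Sum>j<N. \<beta> ^ j * cos (\<phi> + b ^ j * t))"

text \<open>
  At scale \<open>b^(-m)\<close> the \<open>m\<close>-th term dominates: the lower frequencies are controlled by their Lipschitz
  constants and the higher ones by their amplitudes.
\<close>
lemma lacunary_increment:
  assumes b: "b \<ge> 10" and \<beta>: "0 < \<beta>" "\<beta> \<le> 1 / 100" "b * \<beta> \<ge> 100" and m: "m < N"
    and \<tau>: "0 \<le> \<tau>" "\<tau> \<le> 9"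
    and big: "\<bar>cos (\<phi> + b ^ m * t + \<tau>) - cos (\<phi> + b ^ m * t)\<bar> \<ge> 1 / 2"
  shows "\<bar>lacunary b \<beta> \<phi> N (t + \<tau> / b ^ m) - lacunary b \<beta> \<phi> N t\<bar> \<ge> \<beta> ^ m / 4"
proof -
  define d where "d j = \<beta> ^ j * (cos (\<phi> + b ^ j * (t + \<tau> / b ^ m)) - cos (\<phi> + b ^ j * t))" for j
  have "{..<N} = {..<m} \<union> {m} \<union> {Suc m..<N}" using m by auto
  moreover have "sum d ({..<m} \<union> {Suc m..<N}) = (\<Sum>j<m. d j) + (\<Sum>j=Suc m..<N. d j)"
    by (rule sum.union_disjoint) auto
  ultimately have "(\<Sum>j<N. d j) = (\<Sum>j<m. d j) + d m + (\<Sum>j=Suc m..<N. d j)"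
    by simp
  moreover have "lacunary b \<beta> \<phi> N (t + \<tau> / b ^ m) - lacunary b \<beta> \<phi> N t = (\<Sum>j<N. d j)"
    by (simp add: lacunary_def d_def sum_subtractf right_diff_distrib)
  moreover have "\<bar>d m\<bar> \<ge> \<beta> ^ m / 2"
  proof -
    have "b ^ m * (t + \<tau> / b ^ m) = b ^ m * t + \<tau>" using b by (simp add: field_simps)
    hence "\<bar>d m\<bar> = \<beta> ^ m * \<bar>cos (\<phi> + b ^ m * t + \<tau>) - cos (\<phi> + b ^ m * t)\<bar>"
      using \<beta> by (simp add: d_def abs_mult add.assoc)
    also have "\<dots> \<ge> \<beta> ^ m * (1 / 2)" using big \<beta> by (intro mult_left_mono) auto
    finally show ?thesis by simp
  qed
  moreover have "\<bar>\<Sum>j<m. d j\<bar> \<le> \<beta> ^ m / 11"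
  proof -
    have "\<bar>\<Sum>j<m. d j\<bar> \<le> (\<Sum>j<m. \<bar>d j\<bar>)" by (rule sum_abs)
    also have "\<dots> \<le> (\<Sum>j<m. (b * \<beta>) ^ j * (9 / b ^ m))"
    proof (rule sum_mono)
      fix j
      have "\<bar>cos (\<phi> + b ^ j * (t + \<tau> / b ^ m)) - cos (\<phi> + b ^ j * t)\<bar> \<le>
          \<bar>(\<phi> + b ^ j * (t + \<tau> / b ^ m)) - (\<phi> + b ^ j * t)\<bar>" by (rule abs_cos_diff_le)
      also have "\<dots> = b ^ j * (\<tau> / b ^ m)" using b \<tau> by (simp add: distrib_left)
      also have "\<dots> \<le> b ^ j * (9 / b ^ m)" using b \<tau> by (intro mult_left_mono divide_right_mono) auto
      finally have "\<beta> ^ j * \<bar>cos (\<phi> + b ^ j * (t + \<tau> / b ^ m)) - cos (\<phi> + b ^ j * t)\<bar> \<le>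
          \<beta> ^ j * (b ^ j * (9 / b ^ m))"
        using \<beta> by (intro mult_left_mono) auto
      hence "\<bar>d j\<bar> \<le> \<beta> ^ j * (b ^ j * (9 / b ^ m))"
        unfolding d_def abs_mult using \<beta> by simp
      thus "\<bar>d j\<bar> \<le> (b * \<beta>) ^ j * (9 / b ^ m)" by (simp add: power_mult_distrib mult_ac)
    qed
    also have "\<dots> = (\<Sum>j<m. (b * \<beta>) ^ j) * (9 / b ^ m)" by (rule sum_distrib_right[symmetric])
    also have "\<dots> \<le> ((b * \<beta>) ^ m / 99) * (9 / b ^ m)"
    proof (rule mult_right_mono)
      have "(\<Sum>j<m. (b * \<beta>) ^ j) \<le> (b * \<beta>) ^ m / (b * \<beta> - 1)"
        using \<beta> by (intro geometric_sum_le) simp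
      also have "\<dots> \<le> (b * \<beta>) ^ m / 99" using \<beta> b by (intro divide_left_mono) auto
      finally show "(\<Sum>j<m. (b * \<beta>) ^ j) \<le> (b * \<beta>) ^ m / 99" .
    qed (use b in simp)
    also have "\<dots> = \<beta> ^ m / 11" using b by (simp add: power_mult_distrib)
    finally show ?thesis .
  qed
  moreover have "\<bar>\<Sum>j=Suc m..<N. d j\<bar> \<le> \<beta> ^ m * (2 / 99)"
  proof -
    have "\<bar>\<Sum>j=Suc m..<N. d j\<bar> \<le> (\<Sum>j=Suc m..<N. \<bar>d j\<bar>)" by (rule sum_abs)
    also have "\<dots> \<le> (\<Sum>j=Suc m..<N. 2 * \<beta> ^ j)"
    proof (rule sum_mono)
      fix j
      have "\<bar>cos (\<phi> + b ^ j * (t + \<tau> / b ^ m)) - cos (\<phi> + b ^ j * t)\<bar> \<le> 1 + 1"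
        by (rule order_trans[OF abs_triangle_ineq4 add_mono]) auto
      hence "\<bar>d j\<bar> \<le> \<beta> ^ j * 2" using \<beta> by (simp add: d_def abs_mult)
      thus "\<bar>d j\<bar> \<le> 2 * \<beta> ^ j" by simp
    qed
    also have "\<dots> = 2 * (\<Sum>j=Suc m..<N. \<beta> ^ j)" by (simp add: sum_distrib_left)
    also have "\<dots> \<le> 2 * (\<beta> ^ Suc m / (1 - \<beta>))"
      using \<beta> by (intro mult_left_mono geometric_tail_le) auto
    also have "\<dots> = \<beta> ^ m * (2 * \<beta> / (1 - \<beta>))" by simp
    also have "\<dots> \<le> \<beta> ^ m * (2 / 99)" using \<beta> by (intro mult_left_mono) (auto simp: field_simps)
    finally show ?thesis .
  qed
  moreover have "\<beta> ^ m > 0" using \<beta> by simp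
  \<comment> \<open>In units of \<open>\<beta> ^ m\<close>, the middle term minus both perturbations
    is at least 1/2 - 1/11 - 2/99 = 7/18, more than 1/4.\<close>
  ultimately show ?thesis by linarith
qed

text \<open>For every \<open>x\<close> in the unit cube and every \<open>m < N\<close> there is a
  box of increments of volume b^(-m n), at distance of order b^(-m), on which the increment of
  \<open>F\<close> is of order b^(-\<theta> m). The powers of \<open>b\<close> cancel, so each box
  contributes at least the same constant.\<close>

lemma Slobodeckij_lower_bound:
  fixes F :: "real ^ 'n::finite \<Rightarrow> real"
  assumes b: "b \<ge> 10" and \<theta>: "\<theta> > 0" and \<beta>: "b powr (- \<theta>) \<le> 1 / 100" "b * b powr (- \<theta>) \<ge> 100"
    and p: "p > 0" and F: "continuous_on UNIV F"
    and F_eq: "\<And>x. (\<And>i. 0 \<le> x $ i \<and> x $ i \<le> 10) \<Longrightarrow> F x = lacunary b (b powr (- \<theta>)) \<phi> N (x $ i0)"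
    and int: "integrable lborel (Slobodeckij_integrand \<theta> p F)"
  shows "(LINT z|lborel. Slobodeckij_integrand \<theta> p F z) \<ge>
           (1 / 4) powr p / (9 * real CARD('n)) powr (real CARD('n) + \<theta> * p) * real N"
proof -
  let ?n = "CARD('n)" and ?I = "Slobodeckij_integrand \<theta> p F"
  define \<beta>' where "\<beta>' = b powr (- \<theta>)"
  define e where "e = real ?n + \<theta> * p"
  define c where "c = (1 / 4) powr p / (9 * real ?n) powr e"
  have c: "c > 0" by (auto simp: c_def)
  have e: "e > 0" using \<theta> p by (simp add: e_def add_nonneg_pos)
  have \<beta>'0: "\<beta>' > 0" using b by (simp add: \<beta>'_def)
  have n: "?n \<ge> 1" by (simp add: Suc_leI)
  have I[measurable]: "?I \<in> borel_measurable borel" using F by (rule Slobodeckij_integrand_measurable)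
  have I0: "?I z \<ge> 0" for z by (cases z) (simp add: Slobodeckij_integrand_def)
  define Q where "Q = cbox (0 :: real ^ 'n) (\<chi> i. 1)"
  \<comment> \<open>The shifts \<open>a m\<close> depend on \<open>x\<close>. Only the constant
    \<open>c * real N\<close> leaves the inner integral, so they may be chosen pointwise.\<close>
  have inner: "ennreal (c * real N) \<le> (\<integral>\<^sup>+y. ennreal (?I (x, y)) \<partial>lborel)" if x: "x \<in> Q" for x
  proof -
    have x01: "0 \<le> x $ i" "x $ i \<le> 1" for i using x by (auto simp: Q_def mem_box_cart)
    have "\<exists>a. 1 \<le> a \<and> a \<le> 8 \<and> (\<forall>\<tau>. a \<le> \<tau> \<longrightarrow> \<tau> \<le> a + 1 \<longrightarrow>
        \<bar>cos (\<phi> + b ^ m * x $ i0 + \<tau>) - cos (\<phi> + b ^ m * x $ i0)\<bar> \<ge> 1 / 2)" for m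
      by (rule cos_shift_interval[of "\<phi> + b ^ m * x $ i0"]) blast
    then obtain a where a: "\<And>m. 1 \<le> a m" "\<And>m. a m \<le> 8"
      "\<And>m \<tau>. a m \<le> \<tau> \<Longrightarrow> \<tau> \<le> a m + 1 \<Longrightarrow>
        \<bar>cos (\<phi> + b ^ m * x $ i0 + \<tau>) - cos (\<phi> + b ^ m * x $ i0)\<bar> \<ge> 1 / 2"
      by metis
    \<comment> \<open>In direction \<open>i0\<close> the increment runs through the good interval of
      shifts rescaled to b^(-m); the other coordinates, on which \<open>F\<close> does not depend
      near the cube, fill out a cube of the same side.\<close>
    define G where "G m = cbox (\<chi> i. if i = i0 then a m / b ^ m else 0 :: real ^ 'n)
        (\<chi> i. if i = i0 then (a m + 1) / b ^ m else 1 / b ^ m)" for m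
    have bm: "b ^ m > 0" for m using b by simp
    have vol: "emeasure lborel (G m) = ennreal ((1 / b ^ m) ^ ?n)" for m
    proof -
      have "(\<Prod>i\<in>UNIV. (\<chi> i. if i = i0 then (a m + 1) / b ^ m else 1 / b ^ m) $ i -
          (\<chi> i. if i = i0 then a m / b ^ m else 0 :: real ^ 'n) $ i) = (\<Prod>i\<in>(UNIV :: 'n set). 1 / b ^ m)"
        by (intro prod.cong) (auto simp: diff_divide_distrib[symmetric])
      thus ?thesis unfolding G_def using bm[of m]
        by (subst emeasure_cbox_cart) (auto simp: divide_right_mono)
    qed
    have G_i0: "1 \<le> b ^ m * h $ i0" "b ^ m * h $ i0 \<le> 9" "a m \<le> b ^ m * h $ i0" "b ^ m * h $ i0 \<le> a m + 1"
      if "h \<in> G m" for h m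
    proof -
      have "a m / b ^ m \<le> h $ i0" "h $ i0 \<le> (a m + 1) / b ^ m"
        using that by (auto simp: G_def mem_box_cart split: if_splits dest: spec[of _ i0])
      thus "a m \<le> b ^ m * h $ i0" "b ^ m * h $ i0 \<le> a m + 1"
        using bm[of m] by (auto simp: field_simps)
      thus "1 \<le> b ^ m * h $ i0" "b ^ m * h $ i0 \<le> 9" using a(1,2)[of m] by linarith+
    qed
    have G_i: "0 \<le> h $ i" "h $ i \<le> 9 / b ^ m" if "h \<in> G m" for h m i
    proof -
      have "0 \<le> h $ i \<and> h $ i \<le> 9 / b ^ m"
      proof (cases "i = i0")
        case True
        have "0 \<le> b ^ m * h $ i0" using G_i0(1)[OF that] by linarith
        thus ?thesis using True G_i0(2)[OF that] bm[of m] by (auto simp: field_simps zero_le_mult_iff)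
      next
        case False
        hence "0 \<le> h $ i" "h $ i \<le> 1 / b ^ m"
          using that by (auto simp: G_def mem_box_cart dest: spec[of _ i])
        moreover have "1 / b ^ m \<le> 9 / b ^ m" using bm[of m] by (simp add: divide_right_mono)
        ultimately show ?thesis by linarith
      qed
      thus "0 \<le> h $ i" "h $ i \<le> 9 / b ^ m" by auto
    qed
    \<comment> \<open>A common point would give b^m h(i0) in [1, 9] for two different values of
      \<open>m\<close>, but consecutive scales differ by a factor of at least 10.\<close>
    have disj: "m = m'" if "h \<in> G m" "h \<in> G m'" for h m m'
    proof -
      have *: False if "m < m'" "h \<in> G m" "h \<in> G m'" for m m'
      proof -
        have h0: "h $ i0 \<ge> 0" using G_i(1)[OF that(2)] .
        have "b ^ Suc m \<le> b ^ m'" using that(1) b by (intro power_increasing) auto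
        hence "b ^ Suc m * h $ i0 \<le> 9"
          using mult_right_mono[OF _ h0] G_i0(2)[OF that(3)] by (meson order_trans)
        moreover have "10 * 1 \<le> b * (b ^ m * h $ i0)"
          using G_i0(1)[OF that(2)] b by (intro mult_mono) auto
        ultimately show False by simp
      qed
      show ?thesis using *[of m m'] *[of m' m] that by (cases m m' rule: linorder_cases) auto
    qed
    have low: "?I (x, x + h) \<ge> c * (b ^ m) ^ ?n" if h: "h \<in> G m" and m: "m < N" for h m
    proof -
      \<comment> \<open>Coordinates of \<open>x\<close> are at most 1 and those of \<open>h\<close>
        at most 9: this is why \<open>F_eq\<close> is required up to 10.\<close>
      have "9 / b ^ m \<le> 9" using b by (simp add: divide_le_eq one_le_power)
      hence "0 \<le> (x + h) $ i \<and> (x + h) $ i \<le> 10" for i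
        using G_i[OF h, of i] x01[of i] by auto
      hence "F (x + h) = lacunary b \<beta>' \<phi> N ((x + h) $ i0)" unfolding \<beta>'_def by (intro F_eq) blast
      moreover have "(x + h) $ i0 = x $ i0 + (b ^ m * h $ i0) / b ^ m" using b by simp
      moreover have "0 \<le> x $ i \<and> x $ i \<le> 10" for i using x01[of i] by linarith
      hence "F x = lacunary b \<beta>' \<phi> N (x $ i0)" unfolding \<beta>'_def by (intro F_eq) blast
      ultimately have "\<bar>F (x + h) - F x\<bar> \<ge> \<beta>' ^ m / 4"
        using lacunary_increment[of b \<beta>' m N "b ^ m * h $ i0" \<phi> "x $ i0"] b \<beta> \<beta>'0 m
          G_i0[OF h] a(3)[OF G_i0(3,4)[OF h]] by (simp add: \<beta>'_def)
      hence "(\<beta>' ^ m / 4) powr p \<le> \<bar>F x - F (x + h)\<bar> powr p"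
        using p \<beta>'0 by (intro powr_mono2) (auto simp: abs_minus_commute)
      moreover have "\<beta>' ^ m = (b ^ m) powr (- \<theta>)"
        using b by (simp add: \<beta>'_def powr_realpow[symmetric] powr_powr mult.commute)
      hence "(\<beta>' ^ m / 4) powr p = (1 / 4) powr p / (b ^ m) powr (\<theta> * p)"
        using bm[of m] by (simp add: powr_divide powr_mult powr_powr powr_minus_divide)
      ultimately have num: "(1 / 4) powr p / (b ^ m) powr (\<theta> * p) \<le> \<bar>F x - F (x + h)\<bar> powr p" by simp
      have "norm h \<le> (\<Sum>i\<in>UNIV. \<bar>h $ i\<bar>)" by (rule norm_le_l1_cart)
      also have "\<dots> \<le> (\<Sum>i\<in>(UNIV :: 'n set). 9 / b ^ m)" using G_i[OF h] by (intro sum_mono) auto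
      also have "\<dots> = 9 * real ?n / b ^ m" by simp
      finally have "norm h powr e \<le> (9 * real ?n / b ^ m) powr e" using e by (intro powr_mono2) auto
      also have "\<dots> = (9 * real ?n) powr e / ((b ^ m) ^ ?n * (b ^ m) powr (\<theta> * p))"
        using bm[of m] by (simp add: powr_divide e_def powr_add powr_realpow)
      finally have den: "norm h powr e \<le> (9 * real ?n) powr e / ((b ^ m) ^ ?n * (b ^ m) powr (\<theta> * p))" .
      have "h $ i0 \<noteq> 0" using G_i0(1)[OF h] by auto
      hence "norm h powr e > 0" by auto
      \<comment> \<open>The powers with exponent \<open>\<theta> * p\<close> cancel; what remains,
        \<open>(b ^ m) ^ n\<close>, is the reciprocal of the volume of \<open>G m\<close>.\<close>
      have "c * (b ^ m) ^ ?n = ((1 / 4) powr p / (b ^ m) powr (\<theta> * p)) /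
          ((9 * real ?n) powr e / ((b ^ m) ^ ?n * (b ^ m) powr (\<theta> * p)))"
        using bm[of m] b by (simp add: c_def)
      also have "\<dots> \<le> \<bar>F x - F (x + h)\<bar> powr p / norm h powr e"
        using num den \<open>norm h powr e > 0\<close> by (intro frac_le) auto
      finally show ?thesis by (simp add: Slobodeckij_integrand_def e_def)
    qed
    have "ennreal (c * real N) = (\<Sum>m<N. ennreal c)"
      using c by (simp add: ennreal_mult' ennreal_of_nat_eq_real_of_nat mult.commute)
    also have "\<dots> = (\<Sum>m<N. ennreal (c * (b ^ m) ^ ?n) * emeasure lborel (G m))"
      using c bm b by (intro sum.cong) (auto simp: vol ennreal_mult[symmetric] power_one_over less_imp_le)
    also have "\<dots> = (\<integral>\<^sup>+h. (\<Sum>m<N. ennreal (c * (b ^ m) ^ ?n) * indicator (G m) h) \<partial>lborel)"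
      by (subst nn_integral_sum) (auto simp: G_def nn_integral_cmult_indicator)
    also have "\<dots> \<le> (\<integral>\<^sup>+h. ennreal (?I (x, x + h)) \<partial>lborel)"
    proof (rule nn_integral_mono)
      fix h
      show "(\<Sum>m<N. ennreal (c * (b ^ m) ^ ?n) * indicator (G m) h) \<le> ennreal (?I (x, x + h))"
      proof (cases "\<exists>m<N. h \<in> G m")
        case True
        then obtain m where m: "m < N" "h \<in> G m" by blast
        have nG: "h \<notin> G j" if "j \<noteq> m" for j using disj[OF _ m(2)] that by blast
        have "(\<Sum>j<N. ennreal (c * (b ^ j) ^ ?n) * indicator (G j) h) =
            (\<Sum>j\<in>{m}. ennreal (c * (b ^ j) ^ ?n) * indicator (G j) h)"
          by (intro sum.mono_neutral_right) (use m(1) nG in auto)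
        also have "\<dots> = ennreal (c * (b ^ m) ^ ?n)" using m by simp
        finally show ?thesis using low[OF m(2,1)] by (simp add: ennreal_leI)
      next
        case False
        hence "(\<Sum>m<N. ennreal (c * (b ^ m) ^ ?n) * indicator (G m) h) = 0"
          by (intro sum.neutral) auto
        thus ?thesis by simp
      qed
    qed
    also have "\<dots> = (\<integral>\<^sup>+y. ennreal (?I (x, y)) \<partial>lborel)"
    proof (rule nn_integral_translation)
      have "?I \<in> borel_measurable (borel \<Otimes>\<^sub>M borel)" using I by (simp add: borel_prod)
      thus "(\<lambda>y. ennreal (?I (x, y))) \<in> borel_measurable borel" by measurable
    qed
    finally show ?thesis .
  qed
  have "emeasure lborel Q = 1" unfolding Q_def by (subst emeasure_cbox_cart) auto
  hence "ennreal (c * real N) = ennreal (c * real N) * emeasure lborel Q" by simp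
  also have "\<dots> = (\<integral>\<^sup>+x. ennreal (c * real N) * indicator Q x \<partial>lborel)"
    by (rule nn_integral_cmult_indicator[symmetric]) (simp add: Q_def)
  also have "\<dots> \<le> (\<integral>\<^sup>+x. \<integral>\<^sup>+y. ennreal (?I (x, y)) \<partial>lborel \<partial>lborel)"
  proof (rule nn_integral_mono)
    fix x show "ennreal (c * real N) * indicator Q x \<le> (\<integral>\<^sup>+y. ennreal (?I (x, y)) \<partial>lborel)"
      using inner[of x] by (cases "x \<in> Q") auto
  qed
  also have "\<dots> = (\<integral>\<^sup>+z. ennreal (?I z) \<partial>lborel)"
    by (rule nn_integral_lborel_pair(1)[symmetric]) measurable
  also have "\<dots> = ennreal (LINT z|lborel. ?I z)"
    using int I0 by (intro nn_integral_eq_integral) auto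
  finally have "c * real N \<le> (LINT z|lborel. ?I z)"
    using I0 by (subst (asm) ennreal_le_iff) (auto intro: integral_nonneg_AE)
  thus ?thesis by (simp add: c_def e_def)
qed

subsection \<open>Sobolev norms of smooth functions with compact support\<close>

text \<open>Stated for a function \<open>w\<close> known only almost everywhere, so that it applies
  to \<open>weak_deriv\<close>.\<close>

lemma Lp_bound_compact_support:
  fixes F w :: "real ^ 'n::finite \<Rightarrow> real"
  assumes eq: "AE x in lebesgue. w x = F x" and F: "continuous_on UNIV F"
    and K: "compact K" "\<And>x. x \<notin> K \<Longrightarrow> F x = 0" and M: "\<And>x. \<bar>F x\<bar> \<le> M" and q: "q > 0"
  shows "w \<in> Lp_space q" and "Lp_norm q w \<le> M * measure lborel K powr (1 / q)"
proof -
  have M0: "M \<ge> 0" using M[of 0] by linarith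
  have eq': "AE x in lebesgue. F x = w x" using eq by eventually_elim simp
  have "F \<in> borel_measurable lborel" using F by (simp add: borel_measurable_continuous_onI)
  hence mF: "F \<in> borel_measurable lebesgue" by (rule measurable_completion)
  hence mw: "w \<in> borel_measurable lebesgue" using eq' by (rule borel_measurable_AE)
  have cont: "continuous_on UNIV (\<lambda>x. \<bar>F x\<bar> powr q)"
    using F q by (intro continuous_on_powr' continuous_intros) auto
  have int: "integrable lborel (\<lambda>x. \<bar>F x\<bar> powr q)"
    using K q by (intro integrable_compact_support[OF cont K(1)]) auto
  have mp: "(\<lambda>x. \<bar>F x\<bar> powr q) \<in> borel_measurable lborel" using int by (rule borel_measurable_integrable)
  have mFp: "(\<lambda>x. \<bar>F x\<bar> powr q) \<in> borel_measurable lebesgue" using mp by (rule measurable_completion)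
  have ae: "AE x in lebesgue. \<bar>F x\<bar> powr q = \<bar>w x\<bar> powr q" using eq' by eventually_elim simp
  have mwp: "(\<lambda>x. \<bar>w x\<bar> powr q) \<in> borel_measurable lebesgue" using mFp ae by (rule borel_measurable_AE)
  have "integrable lebesgue (\<lambda>x. \<bar>w x\<bar> powr q)"
    using int integrable_cong_AE[OF mFp mwp ae] integrable_completion[OF mp] by simp
  thus "w \<in> Lp_space q" using mw by (simp add: Lp_space_def)
  have Kb: "K \<in> sets lborel" "emeasure lborel K < \<infinity>"
    using K(1) emeasure_compact_finite borel_compact by auto
  have "(LINT x|lebesgue. \<bar>w x\<bar> powr q) = (LINT x|lborel. \<bar>F x\<bar> powr q)"
    using integral_cong_AE[OF mFp mwp ae] integral_completion[OF mp] by simp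
  also have "\<dots> \<le> (LINT x|lborel. M powr q * indicator K x)"
  proof (rule integral_mono[OF int])
    show "integrable lborel (\<lambda>x. M powr q * indicator K x)"
      using Kb by (intro integrable_mult_right integrable_real_indicator)
    show "\<bar>F x\<bar> powr q \<le> M powr q * indicator K x" for x
      using K(2)[of x] M[of x] q by (cases "x \<in> K") (auto intro: powr_mono2)
  qed
  also have "\<dots> = M powr q * measure lborel K" using Kb by simp
  finally have "Lp_norm q w \<le> (M powr q * measure lborel K) powr (1 / q)"
    unfolding Lp_norm_def using q by (intro powr_mono2) auto
  also have "\<dots> = M * measure lborel K powr (1 / q)"
    using M0 q by (simp add: powr_mult powr_powr)
  finally show "Lp_norm q w \<le> M * measure lborel K powr (1 / q)" .
qed

section \<open>Smooth functions with compact support lie in every space\<close>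

lemma frac_bounds: "s \<notin> \<int> \<Longrightarrow> 0 < frac s \<and> frac s < (1 :: real)"
  using frac_ge_0[of s] frac_lt_1[of s] frac_eq_0_iff[of s] by linarith

context
  fixes f :: "real ^ 'n::finite \<Rightarrow> real" and K :: "(real ^ 'n) set"
  assumes smooth: "\<And>k. C_k k f" and K: "compact K" and supp: "\<And>x. x \<notin> K \<Longrightarrow> f x = 0"
begin

lemma foldr_pderiv_smooth: "C_k k (foldr pderiv_dir L f)"
  using smooth by (rule C_k_foldr)

lemma foldr_pderiv_supp: "x \<notin> K \<Longrightarrow> foldr pderiv_dir L f x = 0"
  using foldr_pderiv_outside[of K f x L] supp compact_imp_closed[OF K] by auto

lemma foldr_pderiv_continuous: "continuous_on UNIV (foldr pderiv_dir L f)"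
  using foldr_pderiv_smooth by (rule C_k_continuous)

lemma Sobolev_int_smooth: "q > 0 \<Longrightarrow> f \<in> Sobolev_int k q"
proof -
  assume q: "q > 0"
  have bd: "\<exists>A. \<forall>x. \<bar>foldr pderiv_dir L f x\<bar> \<le> A" for L
    using derivs_bounded_compact_support[OF K foldr_pderiv_smooth[of 0 L] foldr_pderiv_supp] by auto
  have "f \<in> Lp_space q"
    using Lp_bound_compact_support(1)[of f f K _ q] bd[of "[]"] foldr_pderiv_continuous[of "[]"] K supp q by auto
  moreover have "\<exists>v. has_weak_deriv \<nu> f v" for \<nu>
    using has_weak_deriv_classical[OF smooth] by blast
  moreover have "weak_deriv \<nu> f \<in> Lp_space q" for \<nu>
  proof -
    obtain A where "\<And>x. \<bar>foldr pderiv_dir (rev (mi_list \<nu>)) f x\<bar> \<le> A" using bd by blast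
    from Lp_bound_compact_support(1)[OF weak_deriv_classical(2)[OF smooth] foldr_pderiv_continuous K
        foldr_pderiv_supp this q]
    show ?thesis .
  qed
  ultimately show ?thesis by (simp add: Sobolev_int_def)
qed

text \<open>For \<open>N = 0\<close> the modulus is the minimum of t^\<theta>, t and 2, which every
  smooth function with compact support obeys up to a factor. The upper bound above then shows that
  its seminorm is finite.\<close>

lemma modulus_foldr_pderiv:
  assumes "0 < \<theta>" "\<theta> < 1" and b: "b > 0"
  shows "\<exists>M\<ge>0. \<forall>x y. \<bar>foldr pderiv_dir L f x - foldr pderiv_dir L f y\<bar> \<le> M * modulus b \<theta> 0 (norm (x - y))"
proof -
  let ?g = "foldr pderiv_dir L f"
  obtain A where A: "A \<ge> 0" "derivs_bounded 1 1 A ?g"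
    using derivs_bounded_compact_support[OF K foldr_pderiv_smooth[of 1 L] foldr_pderiv_supp] by blast
  have A1: "\<bar>?g x\<bar> \<le> A" for x using A(2) by (rule derivs_bounded_bound)
  have A2: "\<bar>pderiv_dir i ?g x\<bar> \<le> A" for i x using A(2) by simp
  define M where "M = real CARD('n) * A"
  have "1 \<le> real CARD('n)" by (simp add: Suc_leI)
  hence AM: "A \<le> M" using A(1) mult_right_mono[of 1 "real CARD('n)" A] by (simp add: M_def)
  have M: "M \<ge> 0" using A(1) AM by linarith
  have "\<bar>?g x - ?g y\<bar> \<le> (2 * M) * modulus b \<theta> 0 (norm (x - y))" for x y
  proof -
    let ?t = "norm (x - y)"
    have 1: "\<bar>?g x - ?g y\<bar> \<le> M * ?t"
      unfolding M_def by (rule C_k_1_lipschitz[OF foldr_pderiv_smooth A2])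
    have 2: "\<bar>?g x - ?g y\<bar> \<le> M * 2" using A1[of x] A1[of y] AM by linarith
    have 3: "\<bar>?g x - ?g y\<bar> \<le> M * 2 * ?t powr \<theta>"
    proof (cases "?t \<le> 1")
      case True
      have "?t \<le> ?t powr \<theta>"
      proof (cases "?t = 0")
        case False
        have "?t powr 1 \<le> ?t powr \<theta>" using True False assms by (intro powr_mono') auto
        thus ?thesis by simp
      qed simp
      hence "M * ?t \<le> M * ?t powr \<theta>" using M by (rule mult_left_mono)
      moreover have "0 \<le> M * ?t powr \<theta>" using M by simp
      ultimately show ?thesis using 1 by linarith
    next
      case False
      hence "1 \<le> ?t powr \<theta>" using assms by (intro ge_one_powr_ge_zero) auto
      hence "M * 2 * 1 \<le> M * 2 * ?t powr \<theta>" using M by (intro mult_left_mono) auto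
      thus ?thesis using 2 by linarith
    qed
    have "\<bar>?g x - ?g y\<bar> \<le> 2 * M * ?t" "\<bar>?g x - ?g y\<bar> \<le> 2 * M * 2"
      "\<bar>?g x - ?g y\<bar> \<le> 2 * M * ?t powr \<theta>"
      using 1 2 3 M mult_nonneg_nonneg[OF M norm_ge_zero[of "x - y"]] by (auto simp: mult_ac)
    moreover have "modulus b \<theta> 0 ?t = ?t \<or> modulus b \<theta> 0 ?t = 2 \<or> modulus b \<theta> 0 ?t = ?t powr \<theta>"
      using b by (auto simp: modulus_def min_def)
    ultimately show ?thesis by (elim disjE) (simp_all only:)
  qed
  thus ?thesis using M by (intro exI[of _ "2 * M"]) auto
qed

lemma Slobodeckij_integrable:
  assumes "q > 0" "0 < \<theta>" "\<theta> < 1"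
  shows "integrable lborel (Slobodeckij_integrand \<theta> q (foldr pderiv_dir L f))"
proof -
  obtain M where M: "M \<ge> 0"
    "\<forall>x y. \<bar>foldr pderiv_dir L f x - foldr pderiv_dir L f y\<bar> \<le> M * modulus 2 \<theta> 0 (norm (x - y))"
    using modulus_foldr_pderiv[OF assms(2,3), where b = 2 and L = L] by auto
  show ?thesis
    using Slobodeckij_upper_bound[of 2, OF _ assms(2,3,1) K] M foldr_pderiv_continuous foldr_pderiv_supp
    by fastforce
qed

lemma Sobolev_smooth: "q > 0 \<Longrightarrow> f \<in> Sobolev s q"
  using Sobolev_int_smooth Slobodeckij_integrable frac_bounds
    Slobodeckij_integrand_AE_cong(1)[OF weak_deriv_classical(2)[OF smooth] foldr_pderiv_continuous]
  by (auto simp: Sobolev_def)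

lemma Slobodeckij_seminorm_smooth:
  "Slobodeckij_seminorm \<theta> q (weak_deriv \<nu> f) =
    (LINT z|lborel. Slobodeckij_integrand \<theta> q (foldr pderiv_dir (rev (mi_list \<nu>)) f) z) powr (1 / q)"
  unfolding Slobodeckij_seminorm_def
  by (subst Slobodeckij_integrand_AE_cong(2)[OF weak_deriv_classical(2)[OF smooth] foldr_pderiv_continuous]) simp

lemma Sobolev_norm_ge:
  assumes "s \<notin> \<int>" "mi_order \<nu> = nat \<lfloor>s\<rfloor>"
  shows "Sobolev_norm s q f \<ge>
    (LINT z|lborel. Slobodeckij_integrand (frac s) q (foldr pderiv_dir (rev (mi_list \<nu>)) f) z) powr (1 / q)"
proof -
  have "Slobodeckij_seminorm (frac s) q (weak_deriv \<nu> f) \<le>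
      (\<Sum>\<nu> | mi_order \<nu> = nat \<lfloor>s\<rfloor>. Slobodeckij_seminorm (frac s) q (weak_deriv \<nu> f))"
    using assms(2) by (intro member_le_sum finite_mi_order_eq) (auto simp: Slobodeckij_seminorm_def)
  moreover have "Sobolev_int_norm (nat \<lfloor>s\<rfloor>) q f \<ge> 0"
    by (auto simp: Sobolev_int_norm_def Lp_norm_def intro: sum_nonneg)
  ultimately show ?thesis using assms(1) by (simp add: Sobolev_norm_def Slobodeckij_seminorm_smooth)
qed

end

text \<open>The bounds on the derivatives control the integer part by a multiple of
  \<open>M\<close>, and the factor \<open>(real N + 1) powr (1 / q)\<close>, being at least 1,
  absorbs it; the growth stems from the seminorms alone.\<close>

lemma Sobolev_norm_le:
  assumes s: "s \<notin> \<int>" and q: "q > 0" and b: "b > 1" and K: "compact (K :: (real ^ 'n::finite) set)"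
  shows "\<exists>C\<ge>0. \<forall>N f M. (\<forall>k. C_k k f) \<longrightarrow> (\<forall>x. x \<notin> K \<longrightarrow> f x = 0) \<longrightarrow> M \<ge> 0 \<longrightarrow>
    (\<forall>L x. length L \<le> nat \<lfloor>s\<rfloor> \<longrightarrow> \<bar>foldr pderiv_dir L f x\<bar> \<le> M) \<longrightarrow>
    (\<forall>L x y. length L = nat \<lfloor>s\<rfloor> \<longrightarrow>
      \<bar>foldr pderiv_dir L f x - foldr pderiv_dir L f y\<bar> \<le> M * modulus b (frac s) N (norm (x - y))) \<longrightarrow>
    Sobolev_norm s q f \<le> C * M * (real N + 1) powr (1 / q)"
proof -
  let ?k = "nat \<lfloor>s\<rfloor>"
  have \<theta>: "0 < frac s" "frac s < 1" using frac_bounds[OF s] by auto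
  obtain C where C: "C \<ge> 0" "\<And>N F M. continuous_on UNIV F \<Longrightarrow> (\<forall>x. x \<notin> K \<longrightarrow> F x = 0) \<Longrightarrow> M \<ge> 0 \<Longrightarrow>
    (\<forall>x y. \<bar>F x - F y\<bar> \<le> M * modulus b (frac s) N (norm (x - y))) \<Longrightarrow>
    (LINT z|lborel. Slobodeckij_integrand (frac s) q F z) \<le> C * M powr q * (real N + 1)"
    using Slobodeckij_upper_bound[OF b \<theta> q K] by metis
  define V where "V = measure lborel K powr (1 / q)"
  define C' where "C' = real (card {\<nu> :: 'n multi_index. mi_order \<nu> \<le> ?k}) * V +
    real (card {\<nu> :: 'n multi_index. mi_order \<nu> = ?k}) * C powr (1 / q)"
  show ?thesis
  proof (intro exI[of _ C'] conjI allI impI)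
    show "C' \<ge> 0" by (simp add: C'_def V_def)
    fix N and f :: "real ^ 'n \<Rightarrow> real" and M :: real
    assume f: "\<forall>k. C_k k f" "\<forall>x. x \<notin> K \<longrightarrow> f x = 0" and M: "M \<ge> 0"
      and bd: "\<forall>L x. length L \<le> ?k \<longrightarrow> \<bar>foldr pderiv_dir L f x\<bar> \<le> M"
      and mod: "\<forall>L x y. length L = ?k \<longrightarrow>
        \<bar>foldr pderiv_dir L f x - foldr pderiv_dir L f y\<bar> \<le> M * modulus b (frac s) N (norm (x - y))"
    have sm: "\<And>k. C_k k f" and supp: "\<And>x. x \<notin> K \<Longrightarrow> f x = 0" using f by auto
    note facts = foldr_pderiv_continuous[OF sm K supp] foldr_pderiv_supp[OF sm K supp]
    define T where "T = (real N + 1) powr (1 / q)"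
    have T: "T \<ge> 1" using q by (auto simp: T_def intro: ge_one_powr_ge_zero)
    have "Lp_norm q (weak_deriv \<nu> f) \<le> M * V" if "mi_order \<nu> \<le> ?k" for \<nu>
      unfolding V_def
      by (rule Lp_bound_compact_support(2)[OF weak_deriv_classical(2)[OF sm] facts(1) K facts(2) _ q])
         (use bd that in \<open>auto simp: length_mi_list\<close>)
    hence "Sobolev_int_norm ?k q f \<le> (\<Sum>\<nu> | mi_order (\<nu> :: 'n multi_index) \<le> ?k. M * V)"
      unfolding Sobolev_int_norm_def by (intro sum_mono) auto
    also have "\<dots> = real (card {\<nu> :: 'n multi_index. mi_order \<nu> \<le> ?k}) * V * M" by simp
    also have "\<dots> \<le> real (card {\<nu> :: 'n multi_index. mi_order \<nu> \<le> ?k}) * V * M * T"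
      using T M mult_left_mono[of 1 T "real (card {\<nu> :: 'n multi_index. mi_order \<nu> \<le> ?k}) * V * M"]
      by (simp add: V_def)
    finally have 1: "Sobolev_int_norm ?k q f \<le> real (card {\<nu> :: 'n multi_index. mi_order \<nu> \<le> ?k}) * V * M * T" .
    have "Slobodeckij_seminorm (frac s) q (weak_deriv \<nu> f) \<le> C powr (1 / q) * M * T" if "mi_order \<nu> = ?k" for \<nu>
    proof -
      let ?J = "LINT z|lborel. Slobodeckij_integrand (frac s) q (foldr pderiv_dir (rev (mi_list \<nu>)) f) z"
      have "?J \<le> C * M powr q * (real N + 1)"
        by (rule C(2)) (use facts M mod that in \<open>auto simp: length_mi_list\<close>)
      moreover have "?J \<ge> 0"
        by (intro integral_nonneg_AE) (auto simp: Slobodeckij_integrand_def case_prod_beta)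
      moreover have "Slobodeckij_seminorm (frac s) q (weak_deriv \<nu> f) = ?J powr (1 / q)"
        by (rule Slobodeckij_seminorm_smooth[OF sm K supp])
      ultimately have "Slobodeckij_seminorm (frac s) q (weak_deriv \<nu> f) \<le>
          (C * M powr q * (real N + 1)) powr (1 / q)"
        using q by (simp only:) (intro powr_mono2, auto)
      also have "\<dots> = C powr (1 / q) * M * T"
        using q C(1) M by (simp add: T_def powr_mult powr_powr)
      finally show ?thesis .
    qed
    hence "(\<Sum>\<nu> | mi_order \<nu> = ?k. Slobodeckij_seminorm (frac s) q (weak_deriv \<nu> f)) \<le>
        (\<Sum>\<nu> | mi_order (\<nu> :: 'n multi_index) = ?k. C powr (1 / q) * M * T)"
      by (intro sum_mono) auto
    also have "\<dots> = real (card {\<nu> :: 'n multi_index. mi_order \<nu> = ?k}) * C powr (1 / q) * M * T" by simp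
    finally show "Sobolev_norm s q f \<le> C' * M * (real N + 1) powr (1 / q)"
      using 1 s by (simp add: Sobolev_norm_def C'_def T_def algebra_simps)
  qed
qed

text \<open>Each branch of \<open>modulus\<close> is one way of estimating the sum: all terms by
  amplitude, all by Lipschitz constant, or, for the Hoelder branch, a split at the index
  \<open>m\<close> with b^(-m) comparable to \<open>t\<close>. Both geometric sums are dominated by
  their terms next to the split.\<close>

lemma lacunary_modulus:
  assumes b: "b > 1" and \<theta>: "0 < \<theta>" "\<theta> < 1" and \<beta>: "b powr (- \<theta>) \<le> 1 / 2" "b * b powr (- \<theta>) \<ge> 2" and t: "t \<ge> 0"
  shows "(\<Sum>j<N. min ((b powr (- \<theta>)) ^ j) ((b * b powr (- \<theta>)) ^ j * t)) \<le> 4 * modulus b \<theta> N t"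
proof -
  define \<beta>' where "\<beta>' = b powr (- \<theta>)"
  define A where "A = b * \<beta>'"
  have \<beta>': "0 < \<beta>'" "\<beta>' \<le> 1 / 2" and A: "A \<ge> 2" using b \<beta> by (auto simp: \<beta>'_def A_def)
  let ?S = "\<lambda>J. \<Sum>j\<in>J. min (\<beta>' ^ j) (A ^ j * t)"
  have tail: "?S {m..<N} \<le> 2 * \<beta>' ^ m" for m
  proof -
    have "?S {m..<N} \<le> (\<Sum>j=m..<N. \<beta>' ^ j)" by (intro sum_mono) auto
    also have "\<dots> \<le> \<beta>' ^ m / (1 - \<beta>')" using \<beta>' by (intro geometric_tail_le) auto
    also have "\<dots> \<le> \<beta>' ^ m / (1 / 2)" using \<beta>' by (intro divide_left_mono) auto
    finally show ?thesis by simp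
  qed
  have head: "?S {..<m} \<le> A ^ m * t" for m
  proof -
    have "?S {..<m} \<le> (\<Sum>j<m. A ^ j) * t" unfolding sum_distrib_right by (intro sum_mono) auto
    also have "\<dots> \<le> A ^ m / (A - 1) * t" using A t by (intro mult_right_mono geometric_sum_le) auto
    also have "\<dots> \<le> A ^ m / 1 * t" using A t by (intro mult_right_mono divide_left_mono) auto
    finally show ?thesis by simp
  qed
  have 3: "?S {..<N} \<le> 2" using tail[of 0] by (simp add: atLeast0LessThan)
  have A_powr: "A = b powr (1 - \<theta>)" using b by (simp add: A_def \<beta>'_def powr_diff powr_minus divide_inverse)
  have "A ^ N = b powr (real N * (1 - \<theta>))"
    using b by (simp add: A_powr powr_realpow[symmetric] powr_powr mult.commute)
  hence 2: "?S {..<N} \<le> b powr (real N * (1 - \<theta>)) * t" using head[of N] by simp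
  have 1: "?S {..<N} \<le> 4 * t powr \<theta>"
  proof -
    consider "t = 0" | "t \<ge> 1" | "0 < t" "t < 1" using t by linarith
    thus ?thesis
    proof cases
      case 1
      thus ?thesis using head[of N] by simp
    next
      case 2
      hence "1 \<le> t powr \<theta>" using \<theta> by (intro ge_one_powr_ge_zero) auto
      thus ?thesis using 3 by linarith
    next
      case 3
      obtain m where m: "inverse b ^ Suc m \<le> t" "t < b * inverse b ^ Suc m"
        using geometric_interval(1)[OF b 3(1,2)] by blast
      have "\<beta>' ^ Suc m = (inverse b ^ Suc m) powr \<theta>"
        using b by (simp add: \<beta>'_def powr_minus inverse_powr powr_mult power_inverse
            powr_realpow[symmetric] powr_powr mult.commute powr_add[symmetric] distrib_left del: power_Suc)
      also have "\<dots> \<le> t powr \<theta>" using m(1) b \<theta> by (intro powr_mono2) auto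
      finally have tl: "\<beta>' ^ Suc m \<le> t powr \<theta>" .
      have "b ^ m * t \<le> 1" using m(2) b by (simp add: power_inverse field_simps)
      have "A ^ m * t = (b ^ m * t) powr (1 - \<theta>) * t powr \<theta>"
        using b 3 by (simp add: A_powr powr_realpow[symmetric] powr_powr powr_mult mult.commute powr_add[symmetric])
      also have "\<dots> \<le> 1 * t powr \<theta>"
        using \<open>b ^ m * t \<le> 1\<close> b 3 \<theta> by (intro mult_right_mono powr_le1) auto
      finally have hd: "A ^ m * t \<le> t powr \<theta>" by simp
      \<comment> \<open>If \<open>m >= N\<close> the larger index set has additional terms, all
        nonnegative. The constant 4 is 1 for the head, 1 for the term \<open>m\<close> and 2 for the
        tail.\<close>
      have "?S {..<N} \<le> ?S ({..<Suc m} \<union> {Suc m..<N})"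
        using t A \<beta>' by (intro sum_mono2) auto
      also have "\<dots> = ?S {..<m} + min (\<beta>' ^ m) (A ^ m * t) + ?S {Suc m..<N}"
        by (subst sum.union_disjoint) auto
      also have "\<dots> \<le> A ^ m * t + A ^ m * t + 2 * \<beta>' ^ Suc m"
        by (intro add_mono head tail) auto
      also have "\<dots> \<le> 4 * t powr \<theta>" using tl hd by linarith
      finally show ?thesis .
    qed
  qed
  have S0: "?S {..<N} \<ge> 0" using t A \<beta>' by (intro sum_nonneg) auto
  have "4 * modulus b \<theta> N t \<in> {4 * t powr \<theta>, 4 * (b powr (real N * (1 - \<theta>)) * t), 4 * 2}"
    by (auto simp: modulus_def min_def)
  hence "?S {..<N} \<le> 4 * modulus b \<theta> N t" using 1 2 3 S0 by auto
  thus ?thesis by (simp add: A_def \<beta>'_def)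
qed

subsection \<open>The oscillating test functions\<close>

lemma pderiv_dir_cmult:
  "(\<And>x. f differentiable (at x)) \<Longrightarrow> pderiv_dir i (\<lambda>x. c * f x) = (\<lambda>x. c * pderiv_dir i f x)"
  by (subst pderiv_dir_mult) (auto simp: pderiv_dir_const)

lemma derivs_bounded_cmult:
  "C_k k f \<Longrightarrow> derivs_bounded k l A f \<Longrightarrow> derivs_bounded k l (\<bar>c\<bar> * A) (\<lambda>x. c * f x)"
proof (induction k arbitrary: f A)
  case (Suc k)
  have "derivs_bounded k l (\<bar>c\<bar> * (l * A)) (\<lambda>x. c * pderiv_dir i f x)" for i
    by (rule Suc.IH) (use Suc.prems in auto)
  with Suc.prems show ?case
    by (simp add: pderiv_dir_cmult abs_mult mult_left_mono mult.left_commute)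
qed (simp add: abs_mult mult_left_mono)

text \<open>Writing the negative sine as a cosine with shifted phase keeps the family closed under
  differentiation.\<close>

lemma cos_affine_deriv:
  fixes x :: "real ^ 'n::finite"
  shows "(\<lambda>x :: real ^ 'n. cos (\<phi> + l * x $ i)) differentiable (at x)"
    and "pderiv_dir j (\<lambda>x :: real ^ 'n. cos (\<phi> + l * x $ i)) =
      (\<lambda>x. (if i = j then l else 0) * cos (\<phi> + pi / 2 + l * x $ i))"
proof -
  have *: "(cos has_real_derivative cos (\<phi> + pi / 2 + l * y)) (at (\<phi> + l * y))" for y
  proof -
    have "cos (\<phi> + pi / 2 + l * y) = cos ((\<phi> + l * y) + pi / 2)" by (simp add: add_ac)
    also have "\<dots> = - sin (\<phi> + l * y)" by (simp add: cos_add)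
    finally show ?thesis by (auto intro!: derivative_eq_intros)
  qed
  show "(\<lambda>x :: real ^ 'n. cos (\<phi> + l * x $ i)) differentiable (at x)"
    by (rule affine_coord_derivative(1)[OF *])
  show "pderiv_dir j (\<lambda>x :: real ^ 'n. cos (\<phi> + l * x $ i)) =
      (\<lambda>x. (if i = j then l else 0) * cos (\<phi> + pi / 2 + l * x $ i))"
    by (rule ext) (rule affine_coord_derivative(2)[OF *])
qed

lemma C_k_cos_affine: "C_k k (\<lambda>x :: real ^ 'n::finite. cos (\<phi> + l * x $ i))"
proof (induction k arbitrary: \<phi>)
  case 0
  show ?case by (auto intro!: continuous_intros)
next
  case (Suc k)
  have "C_k k (\<lambda>x :: real ^ 'n. (if i = j then l else 0) * cos (\<phi> + pi / 2 + l * x $ i))" for j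
    by (intro C_k_mult C_k_const Suc.IH)
  thus ?case by (simp add: cos_affine_deriv del: C_k.simps(1))
qed

lemma derivs_bounded_cos_affine:
  "l \<ge> 0 \<Longrightarrow> derivs_bounded k l 1 (\<lambda>x :: real ^ 'n::finite. cos (\<phi> + l * x $ i))"
proof (induction k arbitrary: \<phi>)
  case (Suc k)
  have "derivs_bounded k l (l * 1)
      (\<lambda>x :: real ^ 'n. (if i = j then l else 0) * cos (\<phi> + pi / 2 + l * x $ i))" for j
    by (rule derivs_bounded_mono[OF derivs_bounded_cmult[OF C_k_cos_affine Suc.IH]]) (use Suc.prems in auto)
  thus ?case by (simp add: cos_affine_deriv)
qed simp

lemma foldr_pderiv_cos:
  "foldr pderiv_dir (replicate k i) (\<lambda>x :: real ^ 'n::finite. c * cos (\<phi> + l * x $ i)) =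
    (\<lambda>x. c * l ^ k * cos (\<phi> + real k * (pi / 2) + l * x $ i))"
proof (induction k)
  case (Suc k)
  have "foldr pderiv_dir (replicate (Suc k) i) (\<lambda>x :: real ^ 'n. c * cos (\<phi> + l * x $ i)) =
      pderiv_dir i (\<lambda>x. c * l ^ k * cos ((\<phi> + real k * (pi / 2)) + l * x $ i))"
    by (simp only: replicate_Suc foldr_Cons o_apply Suc)
  also have "\<dots> = (\<lambda>x. c * l ^ k * (l * cos (\<phi> + real k * (pi / 2) + pi / 2 + l * x $ i)))"
    by (subst pderiv_dir_cmult) (auto simp: cos_affine_deriv)
  also have "\<dots> = (\<lambda>x. c * l ^ Suc k * cos (\<phi> + real (Suc k) * (pi / 2) + l * x $ i))"
    by (rule ext) (simp add: algebra_simps add_divide_distrib)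
  finally show ?case .
qed simp

text \<open>Both b^\<theta> and b^(1 - \<theta>) have to reach 100, the separation used in
  \<open>lacunary_increment\<close>; this is possible because \<theta> lies strictly between 0 and
  1.\<close>

lemma exists_lacunary_base:
  assumes "0 < \<theta>" "\<theta> < 1"
  obtains b :: real where "b \<ge> 10" "b powr (- \<theta>) \<le> 1 / 100" "b * b powr (- \<theta>) \<ge> 100"
proof -
  define b where "b = max 10 (max (100 powr (1 / \<theta>)) (100 powr (1 / (1 - \<theta>))))"
  have b: "b \<ge> 10" "b \<ge> 100 powr (1 / \<theta>)" "b \<ge> 100 powr (1 / (1 - \<theta>))" by (auto simp: b_def)
  have "b powr \<theta> \<ge> (100 powr (1 / \<theta>)) powr \<theta>" using b(2) assms by (intro powr_mono2) auto
  hence "b powr \<theta> \<ge> 100" using assms by (simp add: powr_powr)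
  hence 1: "b powr (- \<theta>) \<le> 1 / 100"
    unfolding powr_minus_divide by (intro divide_left_mono) auto
  have "b powr (1 - \<theta>) \<ge> (100 powr (1 / (1 - \<theta>))) powr (1 - \<theta>)"
    using b(3) assms by (intro powr_mono2) auto
  hence "b powr (1 - \<theta>) \<ge> 100" using assms by (simp add: powr_powr)
  moreover have "b powr (1 - \<theta>) = b * b powr (- \<theta>)"
    using b(1) powr_add[of b 1 "- \<theta>"] by simp
  ultimately show thesis using that b(1) 1 by simp
qed

lemma powr_growth:
  fixes c D :: real
  assumes "c > 0" "0 < e'" "e' < e"
  obtains N :: nat where "D * (real N + 1) powr e' < c * real N powr e"
proof -
  \<comment> \<open>The factor \<open>2 powr e'\<close> comes from \<open>N + 1 <= 2 * N\<close>;
    the threshold for \<open>N\<close> makes \<open>N powr (e - e')\<close> exceed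
    \<open>X\<close>.\<close>
  define X where "X = \<bar>D\<bar> * 2 powr e' / c"
  obtain N :: nat where N: "real N > max 1 ((X + 1) powr (1 / (e - e')))" using reals_Archimedean2 by blast
  have X: "X \<ge> 0" using assms by (simp add: X_def)
  have "((X + 1) powr (1 / (e - e'))) powr (e - e') < real N powr (e - e')"
    using N assms by (intro powr_less_mono2) auto
  hence "X < real N powr (e - e')" using assms X by (simp add: powr_powr)
  hence "X * real N powr e' < real N powr (e - e') * real N powr e'"
    using N by (intro mult_strict_right_mono) auto
  also have "\<dots> = real N powr e" by (simp add: powr_add[symmetric])
  finally have lt: "\<bar>D\<bar> * (2 powr e' * real N powr e') < c * real N powr e"
    using assms by (simp add: X_def field_simps)
  have "D * (real N + 1) powr e' \<le> \<bar>D\<bar> * (2 * real N) powr e'"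
    using N assms by (intro mult_mono powr_mono2) auto
  also have "\<dots> = \<bar>D\<bar> * (2 powr e' * real N powr e')" by (simp add: powr_mult)
  finally show thesis using lt that[of N] by linarith
qed

text \<open>Of the amplitude b^(-s j), \<open>k\<close> derivatives at frequency b^j leave
  b^(-\<theta> j); one more gives a Lipschitz constant of order b^((1 - \<theta>) j). The cut-off
  has frequency 1, at most b^j, so it costs only the Leibniz constant \<open>C0\<close>. Summing the
  smaller of the two bounds is \<open>lacunary_modulus\<close>.\<close>

lemma oscillating_derivatives:
  fixes \<psi> :: "real ^ 'n::finite \<Rightarrow> real" and i0 :: 'n
  assumes s: "s = real k + \<theta>" "0 < \<theta>" "\<theta> < 1"
    and b: "b \<ge> 1" "b powr (- \<theta>) \<le> 1 / 2" "b * b powr (- \<theta>) \<ge> 2"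
    and \<psi>: "\<And>m. C_k m \<psi>" and A: "A \<ge> 0" "derivs_bounded (Suc k) 1 A \<psi>"
  defines "u \<equiv> \<lambda>N x. \<Sum>j<N. b powr (- s * real j) * (cos (b ^ j * x $ i0) * \<psi> x)"
  shows "\<exists>M\<ge>0. \<forall>N. (\<forall>L x. length L \<le> k \<longrightarrow> \<bar>foldr pderiv_dir L (u N) x\<bar> \<le> M) \<and>
    (\<forall>L x y. length L = k \<longrightarrow> \<bar>foldr pderiv_dir L (u N) x - foldr pderiv_dir L (u N) y\<bar> \<le>
      M * modulus b \<theta> N (norm (x - y)))"
proof -
  define \<beta> where "\<beta> = b powr (- \<theta>)"
  define w where "w j x = b powr (- s * real j) * (cos (0 + b ^ j * x $ i0) * \<psi> x)" for j x
  define C0 where "C0 = 2 ^ Suc k * 1 * A"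
  define M where "M = real CARD('n) * (2 * C0)"
  have \<beta>: "0 < \<beta>" "\<beta> \<le> 1 / 2" using b by (auto simp: \<beta>_def)
  have C0: "C0 \<ge> 0" using A by (simp add: C0_def)
  have "1 \<le> real CARD('n)" by (simp add: Suc_leI)
  hence CM: "2 * C0 \<le> M" using C0 mult_right_mono[of 1 "real CARD('n)" "2 * C0"] by (simp add: M_def)
  have M: "M \<ge> 0" using CM C0 by linarith
  have u: "u N = (\<lambda>x. \<Sum>j<N. w j x)" for N by (simp add: u_def w_def)
  have Cw: "C_k m (w j)" for m j
    unfolding w_def by (intro C_k_mult C_k_const C_k_cos_affine \<psi>)
  have Du: "foldr pderiv_dir L (u N) x = (\<Sum>j<N. foldr pderiv_dir L (w j) x)" for L N x
    unfolding u by (subst foldr_pderiv_sum) (auto intro: Cw)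
  have bj: "b ^ j \<ge> 1" for j using b(1) by (rule one_le_power)
  have dw: "\<bar>foldr pderiv_dir L (w j) x\<bar> \<le> (b ^ j) ^ length L * (b powr (- s * real j) * C0)"
    if "length L \<le> Suc k" for L j x
  proof (rule derivs_bounded_foldr[OF _ that])
    have "derivs_bounded (Suc k) (b ^ j) (\<bar>b powr (- s * real j)\<bar> * C0) (w j)"
      unfolding w_def C0_def using bj[of j]
      by (intro derivs_bounded_cmult derivs_bounded_mult C_k_mult C_k_cos_affine \<psi>
          derivs_bounded_cos_affine derivs_bounded_mono[OF A(2)] A(1)) auto
    thus "derivs_bounded (Suc k) (b ^ j) (b powr (- s * real j) * C0) (w j)" by simp
  qed
  have pw: "(b ^ j) ^ k * b powr (- s * real j) = \<beta> ^ j" for j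
    using b(1) by (simp add: \<beta>_def s(1) powr_realpow[symmetric] powr_powr powr_add[symmetric] algebra_simps)
  have d0: "\<bar>foldr pderiv_dir L (w j) x\<bar> \<le> \<beta> ^ j * C0" if "length L \<le> k" for L j x
  proof -
    have "(b ^ j) ^ length L * (b powr (- s * real j) * C0) \<le> (b ^ j) ^ k * (b powr (- s * real j) * C0)"
      using that bj[of j] C0 by (intro mult_right_mono power_increasing) auto
    also have "\<dots> = \<beta> ^ j * C0" using pw[of j] by (simp add: mult.assoc[symmetric])
    finally show ?thesis using dw[of L j x] that by simp
  qed
  have d1: "\<bar>foldr pderiv_dir L (w j) x - foldr pderiv_dir L (w j) y\<bar> \<le>
      M * min (\<beta> ^ j) ((b * \<beta>) ^ j * norm (x - y))" if L: "length L = k" for L j x y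
  proof -
    have "\<beta> ^ j * (2 * C0) \<le> \<beta> ^ j * M" using CM \<beta> by (intro mult_left_mono) auto
    hence 1: "\<bar>foldr pderiv_dir L (w j) x - foldr pderiv_dir L (w j) y\<bar> \<le> M * \<beta> ^ j"
      using d0[of L j x] d0[of L j y] L by (simp add: mult.commute[of M])
    have "\<bar>pderiv_dir i (foldr pderiv_dir L (w j)) z\<bar> \<le> (b * \<beta>) ^ j * C0" for i z
    proof -
      have "\<bar>foldr pderiv_dir (i # L) (w j) z\<bar> \<le> (b ^ j) ^ Suc k * (b powr (- s * real j) * C0)"
        using dw[of "i # L" j z] L by simp
      also have "\<dots> = b ^ j * ((b ^ j) ^ k * b powr (- s * real j)) * C0" by (simp only: power_Suc mult_ac)
      also have "\<dots> = (b * \<beta>) ^ j * C0" by (simp only: pw power_mult_distrib)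
      finally show ?thesis by simp
    qed
    from C_k_1_lipschitz[OF C_k_foldr[OF Cw] this]
    have "\<bar>foldr pderiv_dir L (w j) x - foldr pderiv_dir L (w j) y\<bar> \<le>
        real CARD('n) * ((b * \<beta>) ^ j * C0) * norm (x - y)" .
    also have "\<dots> = (real CARD('n) * C0) * ((b * \<beta>) ^ j * norm (x - y))" by (simp only: mult_ac)
    also have "\<dots> \<le> M * ((b * \<beta>) ^ j * norm (x - y))"
      using C0 b \<beta> by (intro mult_right_mono) (auto simp: M_def)
    finally have 2: "\<bar>foldr pderiv_dir L (w j) x - foldr pderiv_dir L (w j) y\<bar> \<le>
        M * ((b * \<beta>) ^ j * norm (x - y))" .
    show ?thesis using 1 2 by (simp add: min_def)
  qed
  show ?thesis
  proof (intro exI[of _ "4 * M"] conjI allI impI)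
    show "4 * M \<ge> 0" using M by simp
  next
    fix N L x assume L: "length (L :: 'n list) \<le> k"
    have "\<bar>foldr pderiv_dir L (u N) x\<bar> \<le> (\<Sum>j<N. \<bar>foldr pderiv_dir L (w j) x\<bar>)"
      unfolding Du by (rule sum_abs)
    also have "\<dots> \<le> (\<Sum>j<N. \<beta> ^ j * C0)" by (intro sum_mono d0 L)
    also have "\<dots> = (\<Sum>j=0..<N. \<beta> ^ j) * C0" by (simp add: sum_distrib_right atLeast0LessThan)
    also have "\<dots> \<le> (\<beta> ^ 0 / (1 - \<beta>)) * C0"
      using \<beta> C0 by (intro mult_right_mono geometric_tail_le) auto
    also have "\<dots> \<le> 2 * C0" using \<beta> C0 by (intro mult_right_mono) (auto simp: field_simps)
    finally show "\<bar>foldr pderiv_dir L (u N) x\<bar> \<le> 4 * M" using CM M by linarith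
  next
    fix N L x y assume L: "length (L :: 'n list) = k"
    have "\<bar>foldr pderiv_dir L (u N) x - foldr pderiv_dir L (u N) y\<bar> =
        \<bar>\<Sum>j<N. foldr pderiv_dir L (w j) x - foldr pderiv_dir L (w j) y\<bar>"
      by (simp add: Du sum_subtractf)
    also have "\<dots> \<le> (\<Sum>j<N. \<bar>foldr pderiv_dir L (w j) x - foldr pderiv_dir L (w j) y\<bar>)"
      by (rule sum_abs)
    also have "\<dots> \<le> (\<Sum>j<N. M * min (\<beta> ^ j) ((b * \<beta>) ^ j * norm (x - y)))"
      by (intro sum_mono d1 L)
    also have "\<dots> = M * (\<Sum>j<N. min (\<beta> ^ j) ((b * \<beta>) ^ j * norm (x - y)))"
      by (simp add: sum_distrib_left)
    also have "\<dots> \<le> M * (4 * modulus b \<theta> N (norm (x - y)))"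
    proof (rule mult_left_mono[OF _ M])
      have "b \<noteq> 1" using b by auto
      thus "(\<Sum>j<N. min (\<beta> ^ j) ((b * \<beta>) ^ j * norm (x - y))) \<le> 4 * modulus b \<theta> N (norm (x - y))"
        unfolding \<beta>_def using b s by (intro lacunary_modulus) auto
    qed
    finally show "\<bar>foldr pderiv_dir L (u N) x - foldr pderiv_dir L (u N) y\<bar> \<le>
        4 * M * modulus b \<theta> N (norm (x - y))" by simp
  qed
qed

section \<open>Comparing the growth of the two norms in \<open>N\<close>\<close>

theorem proposition4p3:
  fixes s s2 p1 p2 p :: real
  assumes "s \<ge> 0" and "s2 \<ge> 0" and "s \<notin> \<int>"
    and "p1 > 1" and "p2 > 1" and "p > 1"
    and "\<And>u v :: real ^ 'n::finite \<Rightarrow> real.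
           u \<in> Sobolev s p1 \<Longrightarrow> v \<in> Sobolev s2 p2 \<Longrightarrow> (\<lambda>x. u x * v x) \<in> Sobolev s p"
    and "\<exists>C::real. \<forall>(u :: real ^ 'n \<Rightarrow> real) v.
           u \<in> Sobolev s p1 \<longrightarrow> v \<in> Sobolev s2 p2 \<longrightarrow>
           Sobolev_norm s p (\<lambda>x. u x * v x) \<le> C * Sobolev_norm s p1 u * Sobolev_norm s2 p2 v"
  shows "p1 \<le> p"
proof (rule ccontr)
  assume "\<not> p1 \<le> p"
  define k \<theta> where "k = nat \<lfloor>s\<rfloor>" and "\<theta> = frac s"
  have \<theta>: "0 < \<theta>" "\<theta> < 1" using frac_bounds[OF assms(3)] by (auto simp: \<theta>_def)
  have s: "s = real k + \<theta>" using assms(1) by (simp add: k_def \<theta>_def frac_def)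
  obtain b where b: "b \<ge> 10" "b powr (- \<theta>) \<le> 1 / 100" "b * b powr (- \<theta>) \<ge> 100"
    using exists_lacunary_base[OF \<theta>] by blast
  define i0 :: 'n where "i0 = undefined"
  \<comment> \<open>With transition layers of width 1, this cut-off equals 1 on a neighbourhood of
    the cube [0, 10]^n where the lower bound is evaluated.\<close>
  define \<psi> :: "real ^ 'n \<Rightarrow> real" where "\<psi> = box_bump 1 (\<chi> i. - 2) (\<chi> i. 12)"
  define K :: "(real ^ 'n) set" where "K = cbox (\<chi> i. - 2) (\<chi> i. 12)"
  have \<psi>C: "C_k m \<psi>" for m unfolding \<psi>_def by (rule C_k_box_bump)
  have K: "compact K" by (simp add: K_def)
  have \<psi>K: "\<psi> x = 0" if "x \<notin> K" for x
    unfolding \<psi>_def by (rule box_bump_0) (use that box_subset_cbox in \<open>auto simp: K_def\<close>)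
  have \<psi>1: "\<psi> x = 1" if "x \<in> box (\<chi> i. - 1) (\<chi> i. 11)" for x
  proof -
    have *: "- 1 < x $ i" "x $ i < 11" for i using that by (auto simp: mem_box_cart)
    show ?thesis unfolding \<psi>_def
    proof (rule box_bump_1)
      fix i
      show "1 \<le> 1 * (x $ i - (\<chi> i. - 2) $ i)" "1 \<le> 1 * ((\<chi> i. 12) $ i - x $ i)"
        using *[of i] by auto
    qed
  qed
  obtain A where A: "A \<ge> 0" "derivs_bounded (Suc k) 1 A \<psi>"
    using derivs_bounded_compact_support[OF K \<psi>C \<psi>K] by blast
  define u where "u N x = (\<Sum>j<N. b powr (- s * real j) * (cos (b ^ j * x $ i0) * \<psi> x))" for N x
  have uC: "C_k m (u N)" for m N
    unfolding u_def using C_k_cos_affine[of m 0]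
    by (intro C_k_sum C_k_mult C_k_const \<psi>C) simp
  have uK: "u N x = 0" if "x \<notin> K" for N x using \<psi>K[OF that] by (simp add: u_def)
  obtain M where M: "M \<ge> 0"
    "\<And>N L x. length L \<le> k \<Longrightarrow> \<bar>foldr pderiv_dir L (u N) x\<bar> \<le> M"
    "\<And>N L x y. length L = k \<Longrightarrow> \<bar>foldr pderiv_dir L (u N) x - foldr pderiv_dir L (u N) y\<bar> \<le>
      M * modulus b \<theta> N (norm (x - y))"
    using oscillating_derivatives[OF s \<theta> _ _ _ \<psi>C A, of b i0] b unfolding u_def[abs_def] by auto
  obtain C1 where C1: "C1 \<ge> 0" "\<And>N. Sobolev_norm s p1 (u N) \<le> C1 * M * (real N + 1) powr (1 / p1)"
  proof -
    obtain C1 where "C1 \<ge> 0" and C1: "\<And>N f M. (\<forall>k. C_k k f) \<Longrightarrow> (\<forall>x. x \<notin> K \<longrightarrow> f x = 0) \<Longrightarrow> M \<ge> 0 \<Longrightarrow>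
      (\<forall>L x. length L \<le> nat \<lfloor>s\<rfloor> \<longrightarrow> \<bar>foldr pderiv_dir L f x\<bar> \<le> M) \<Longrightarrow>
      (\<forall>L x y. length L = nat \<lfloor>s\<rfloor> \<longrightarrow>
        \<bar>foldr pderiv_dir L f x - foldr pderiv_dir L f y\<bar> \<le> M * modulus b (frac s) N (norm (x - y))) \<Longrightarrow>
      Sobolev_norm s p1 f \<le> C1 * M * (real N + 1) powr (1 / p1)"
      using Sobolev_norm_le[OF assms(3) _ _ K, of p1 b] assms(4) b(1) by auto
    have "Sobolev_norm s p1 (u N) \<le> C1 * M * (real N + 1) powr (1 / p1)" for N
      by (rule C1) (use uC uK M in \<open>auto simp: k_def \<theta>_def\<close>)
    thus thesis using that \<open>C1 \<ge> 0\<close> by blast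
  qed
  \<comment> \<open>The pure derivative in direction \<open>i0\<close>, along which the cosines
    oscillate.\<close>
  define \<nu> :: "'n multi_index" where "\<nu> = (\<lambda>i. if i = i0 then k else 0)"
  have \<nu>: "mi_order \<nu> = k" by (simp add: mi_order_def \<nu>_def)
  have list: "rev (mi_list \<nu>) = replicate k i0"
  proof -
    have "set (mi_list \<nu>) \<subseteq> {i0}" by (auto simp: mi_list_def \<nu>_def split: if_splits)
    hence "mi_list \<nu> = replicate k i0"
      using length_mi_list[of \<nu>] \<nu> by (intro replicate_eqI) auto
    thus ?thesis by simp
  qed
  define f where "f N x = u N x * \<psi> x" for N x
  have fC: "C_k m (f N)" for m N unfolding f_def by (intro C_k_mult uC \<psi>C)
  have fK: "f N x = 0" if "x \<notin> K" for N x using \<psi>K[OF that] by (simp add: f_def)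
  define c where "c = (1 / 4) powr p / (9 * real CARD('n)) powr (real CARD('n) + \<theta> * p)"
  have c: "c > 0" by (auto simp: c_def)
  have lower: "(c * real N) powr (1 / p) \<le> Sobolev_norm s p (f N)" for N
  proof -
    let ?F = "foldr pderiv_dir (replicate k i0) (f N)"
    have "?F x = lacunary b (b powr (- \<theta>)) (real k * (pi / 2)) N (x $ i0)"
      if "\<And>i. 0 \<le> x $ i \<and> x $ i \<le> 10" for x
    proof -
      \<comment> \<open>An open set around the closed cube, as derivatives only see neighbourhoods.
        Both factors \<psi> in \<open>f N\<close> equal 1 on it.\<close>
      let ?U = "box (\<chi> i. - 1) (\<chi> i. 11 :: real ^ 'n)"
      have "?F x = foldr pderiv_dir (replicate k i0)
          (\<lambda>x. \<Sum>j<N. b powr (- s * real j) * cos (0 + b ^ j * x $ i0)) x"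
      proof (rule foldr_pderiv_cong[of ?U])
        show "x \<in> ?U" unfolding mem_box_cart
        proof
          fix i show "(\<chi> i. - 1) $ i < x $ i \<and> x $ i < (\<chi> i. 11) $ i" using that[of i] by simp
        qed
        show "f N y = (\<Sum>j<N. b powr (- s * real j) * cos (0 + b ^ j * y $ i0))" if "y \<in> ?U" for y
          using \<psi>1[OF that] by (simp add: f_def u_def)
      qed (rule open_box)
      also have "\<dots> = (\<Sum>j<N. foldr pderiv_dir (replicate k i0)
          (\<lambda>x. b powr (- s * real j) * cos (0 + b ^ j * x $ i0)) x)"
        by (subst foldr_pderiv_sum) (auto intro!: C_k_mult C_k_const C_k_cos_affine simp del: add_0)
      also have "\<dots> = (\<Sum>j<N. b powr (- s * real j) * (b ^ j) ^ k *
          cos (0 + real k * (pi / 2) + b ^ j * x $ i0))"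
        by (simp only: foldr_pderiv_cos)
      also have "\<dots> = lacunary b (b powr (- \<theta>)) (real k * (pi / 2)) N (x $ i0)"
        unfolding lacunary_def
      proof (rule sum.cong[OF refl])
        fix j
        have "b powr (- s * real j) * (b ^ j) ^ k = (b powr (- \<theta>)) ^ j"
          using b(1) by (simp add: s powr_realpow[symmetric] powr_powr powr_add[symmetric] algebra_simps)
        thus "b powr (- s * real j) * (b ^ j) ^ k * cos (0 + real k * (pi / 2) + b ^ j * x $ i0) =
            (b powr (- \<theta>)) ^ j * cos (real k * (pi / 2) + b ^ j * x $ i0)" by simp
      qed
      finally show ?thesis .
    qed
    hence "c * real N \<le> (LINT z|lborel. Slobodeckij_integrand \<theta> p ?F z)"
      unfolding c_def using b \<theta> assms(6)
        foldr_pderiv_continuous[OF fC K fK] Slobodeckij_integrable[OF fC K fK _ \<theta>]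
      by (intro Slobodeckij_lower_bound) (auto simp del: foldr_replicate)
    hence "(c * real N) powr (1 / p) \<le> (LINT z|lborel. Slobodeckij_integrand \<theta> p ?F z) powr (1 / p)"
      using c assms(6) by (intro powr_mono2) auto
    also have "\<dots> \<le> Sobolev_norm s p (f N)"
      using Sobolev_norm_ge[OF fC K fK assms(3), of \<nu> p] \<nu> by (simp add: list k_def \<theta>_def)
    finally show ?thesis .
  qed
  have pos: "Sobolev_norm s p1 (u N) \<ge> 0" for N
    using Sobolev_norm_ge[OF uC K uK assms(3), of \<nu> p1] \<nu> by (auto simp: k_def intro: order_trans[OF powr_ge_zero])
  obtain C where C: "\<And>(u :: real ^ 'n \<Rightarrow> real) v. u \<in> Sobolev s p1 \<Longrightarrow> v \<in> Sobolev s2 p2 \<Longrightarrow>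
      Sobolev_norm s p (\<lambda>x. u x * v x) \<le> C * Sobolev_norm s p1 u * Sobolev_norm s2 p2 v"
    using assms(8) by blast
  \<comment> \<open>Absolute values, since the hypothesis says nothing about the sign of
    \<open>C\<close>.\<close>
  define D where "D = \<bar>C\<bar> * (C1 * M) * \<bar>Sobolev_norm s2 p2 \<psi>\<bar>"
  have upper: "c powr (1 / p) * real N powr (1 / p) \<le> D * (real N + 1) powr (1 / p1)" for N
  proof -
    have "c powr (1 / p) * real N powr (1 / p) = (c * real N) powr (1 / p)"
      using c by (simp add: powr_mult)
    also have "\<dots> \<le> Sobolev_norm s p (f N)" by (rule lower)
    also have "\<dots> \<le> C * Sobolev_norm s p1 (u N) * Sobolev_norm s2 p2 \<psi>"
      unfolding f_def using assms(4,5)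
      by (intro C Sobolev_smooth[OF uC K uK] Sobolev_smooth[OF \<psi>C K \<psi>K]) auto
    also have "\<dots> \<le> \<bar>C * Sobolev_norm s p1 (u N) * Sobolev_norm s2 p2 \<psi>\<bar>" by (rule abs_ge_self)
    also have "\<dots> = \<bar>C\<bar> * Sobolev_norm s p1 (u N) * \<bar>Sobolev_norm s2 p2 \<psi>\<bar>"
      using pos[of N] by (simp add: abs_mult)
    also have "\<dots> \<le> \<bar>C\<bar> * (C1 * M * (real N + 1) powr (1 / p1)) * \<bar>Sobolev_norm s2 p2 \<psi>\<bar>"
      by (intro mult_right_mono mult_left_mono C1(2)) auto
    finally show ?thesis by (simp add: D_def mult_ac)
  qed
  have "0 < 1 / p1" "1 / p1 < 1 / p"
    using \<open>\<not> p1 \<le> p\<close> assms(4,6) by (auto simp: field_simps)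
  moreover have "c powr (1 / p) > 0" using c by simp
  ultimately obtain N where "D * (real N + 1) powr (1 / p1) < c powr (1 / p) * real N powr (1 / p)"
    using powr_growth by blast
  thus False using upper[of N] by simp
qed

end
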